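(* Let $n\ge1$ and $w\in W^{\mathsf{D}}_n$. Then \[ \mathfrak{G}^{\mathsf{D}}_w(x_i \mapsto q^{i-1}) = \sum_{a \in \mathsf{PrimedHecke}^\pm_D(w)} \frac{\beta^{\ell(a) - \ell(w)}}{(q^2-1)(q^{4}-1)\cdots (q^{2\ell(a)}-1)}\, q^{\Sigma_{\mathsf{D}}(a)+\operatorname{comaj}_{\mathsf{D}}(a)}, \] where each summand on the right is expanded as a Laurent series in $q^{-1}$.
   Context: Let $x_i$ ($i\in\mathbb{Z}$) be commuting indeterminates and $\beta$ an indeterminate. For $1<i<n$ let $r_i=r_{-i}=(i,i+1)(-i,-i-1)$, and $r_1=(1,2)(-1,-2)$, $r_{-1}=(1,-2)(-1,2)$; $W^{\mathsf{D}}_n=\langle r_{-1},r_1,\dots,r_{n-1}\rangle$ (permutations $w$ of $\mathbb{Z}$ with $w(i)=i$ for $|i|>n$, $w(-i)=-w(i)$, and an even number of positive $i$ with $w(i)<0$), with Coxeter length $\ell$. Consider the id-Coxeter algebra over $\mathbb{Z}[\beta]$ with basis $\pi_v$, relations $\pi_u\pi_v=\pi_{uv}$ if $\ell(uv)=\ell(u)+\ell(v)$ and $\pi_s^2=\beta\pi_s$ for simple $s$; write $\pi_a=\pi_{r_a}$. $\mathsf{Hecke}^\pm_D(w)$ is the set of words $a_1\cdots a_N$ with letters in $\{\pm1,\dots,\pm(n-1)\}$ with $\pi_{a_1}\cdots\pi_{a_N}=\beta^{N-\ell(w)}\pi_w$. For an integer word $a=a_1\cdots a_p$, a bounded compatible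 sequence is a weakly increasing integer sequence $\mathbf{i}=(i_1\le\dots\le i_p)$ with $i_j<i_{j+1}$ whenever $a_j\le a_{j+1}$ and $i_j\le a_j$ whenever $0<i_j$; $\mathsf{Compatible}(a)$ is the set of these, $\ell(\mathbf{i})=p$, $x_{\mathbf{i}}=x_{i_1}\cdots x_{i_p}$. Define $\mathfrak{G}^{\mathsf{D}}_w=\sum_{a\in\mathsf{Hecke}^\pm_D(w)}\sum_{\mathbf{i}\in\mathsf{Compatible}(a)}\beta^{\ell(\mathbf{i})-\ell(w)}x_{\mathbf{i}}$. $F(x_i\mapsto q^{i-1})$ means setting $x_i=q^{i-1}$ for all $i<n$. Consider the ordered alphabet $-1'\prec-1\prec-2'\prec-2\prec\dots\prec-n'\prec-n\prec1'\prec1\prec2'\prec2\prec\dots\prec n'\prec n$. $\mathsf{PrimedHecke}^\pm_D(w)$ is the set of words in this alphabet that become elements of $\mathsf{Hecke}^\pm_D(w)$ after removing all primes. For such $a=a_1\cdots a_p$, $\ell(a)=p$; let $J(a)$ be the set of indices $i$ with $a_i$ unprimed, $\Sigma_{\mathsf{D}}(a)=\sum_{i\in J(a)}|a_i|$ (absolute value of the unprimed letter), and $\operatorname{comaj}_{\mathsf{D}}(a)=|\{i:a_i\in\{1',1,2',2,\dots\}\}|+\sum_{i:\,a_i\prec a_{i+1}}2i$. *)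

theory Defs
  imports
    "HOL-Combinatorics.Permutations"
    "HOL-Library.Multiset"
    "HOL-Computational_Algebra.Formal_Laurent_Series"
    "HOL-Computational_Algebra.Polynomial_FPS"
begin

notation fls_nth (infixl \<open>$$\<close> 75)

section \<open>The Coxeter group of type D\<close>

definition WD :: "nat \<Rightarrow> (int \<Rightarrow> int) set" where
  "WD n = {w. w permutes {- int n..int n} \<and> (\<forall>i. w (- i) = - w i) \<and>
              even (card {i. 0 < i \<and> w i < 0})}"

definition letters :: "nat \<Rightarrow> int set" where
  "letters n = {a. 1 \<le> \<bar>a\<bar> \<and> \<bar>a\<bar> < int n}"

definition refl_D :: "int \<Rightarrow> int \<Rightarrow> int" where
  "refl_D a = (if a = -1 then transpose 1 (-2) \<circ> transpose (-1) 2
               else transpose \<bar>a\<bar> (\<bar>a\<bar> + 1) \<circ> transpose (- \<bar>a\<bar>) (- \<bar>a\<bar> - 1))"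

definition word_perm :: "int list \<Rightarrow> int \<Rightarrow> int" where
  "word_perm a = foldr (\<lambda>b u. refl_D b \<circ> u) a id"

definition len_D :: "nat \<Rightarrow> (int \<Rightarrow> int) \<Rightarrow> nat" where
  "len_D n w = (LEAST k. \<exists>a. set a \<subseteq> letters n \<and> length a = k \<and> word_perm a = w)"

section \<open>Hecke words and Grothendieck series\<close>

text \<open>
  An id-Coxeter algebra over \<open>\<int>[\<beta>]\<close>, i.e. over \<^typ>\<open>int poly\<close> with \<open>\<beta> = [:0, 1:]\<close>.
  The axioms determine the algebra up to isomorphism, and they force \<open>\<pi> id = 1\<close>.
\<close>

locale id_coxeter_algebra_D = module scale
  for scale :: "int poly \<Rightarrow> 'h::ring_1 \<Rightarrow> 'h" +
  fixes n :: nat and \<pi> :: "(int \<Rightarrow> int) \<Rightarrow> 'h"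
  assumes scale_mult_left: "scale c x * y = scale c (x * y)"
    and scale_mult_right: "x * scale c y = scale c (x * y)"
    and basis_inj: "inj_on \<pi> (WD n)"
    and basis_independent: "independent (\<pi> ` WD n)"
    and basis_span: "span (\<pi> ` WD n) = UNIV"
    and mult_reduced: "\<lbrakk>u \<in> WD n; v \<in> WD n; len_D n (u \<circ> v) = len_D n u + len_D n v\<rbrakk>
                        \<Longrightarrow> \<pi> u * \<pi> v = \<pi> (u \<circ> v)"
    and mult_simple: "a \<in> letters n
                        \<Longrightarrow> \<pi> (refl_D a) * \<pi> (refl_D a) = scale [:0, 1:] (\<pi> (refl_D a))"

text \<open>The condition \<open>len_D n w \<le> length a\<close> makes the exponent of \<open>\<beta>\<close> an honest difference.\<close>

definition Hecke_D ::
  "nat \<Rightarrow> (int poly \<Rightarrow> 'h \<Rightarrow> 'h) \<Rightarrow> ((int \<Rightarrow> int) \<Rightarrow> 'h::ring_1) \<Rightarrow> (int \<Rightarrow> int) \<Rightarrow> int list set" where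
  "Hecke_D n scale \<pi> w =
     {a. set a \<subseteq> letters n \<and> len_D n w \<le> length a \<and>
         prod_list (map (\<lambda>b. \<pi> (refl_D b)) a) = scale ([:0, 1:] ^ (length a - len_D n w)) (\<pi> w)}"

definition Compatible :: "int list \<Rightarrow> int list set" where
  "Compatible a =
     {i. length i = length a \<and> sorted i \<and>
         (\<forall>j. Suc j < length a \<longrightarrow> a ! j \<le> a ! Suc j \<longrightarrow> i ! j < i ! Suc j) \<and>
         (\<forall>j < length a. 0 < i ! j \<longrightarrow> i ! j \<le> a ! j)}"

text \<open>
  A formal power series over \<open>\<int>[\<beta>]\<close> in the variables \<open>x\<^sub>i\<close> (\<open>i \<in> \<int>\<close>) is given by its coefficients,
  a monomial being the finite multiset of the indices of its variables.
\<close>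

type_synonym xseries = "int multiset \<Rightarrow> int poly"

definition Groth_D ::
  "nat \<Rightarrow> (int poly \<Rightarrow> 'h \<Rightarrow> 'h) \<Rightarrow> ((int \<Rightarrow> int) \<Rightarrow> 'h::ring_1) \<Rightarrow> (int \<Rightarrow> int) \<Rightarrow> xseries" where
  "Groth_D n scale \<pi> w M =
     (\<Sum>(a, i) \<in> {(a, i). a \<in> Hecke_D n scale \<pi> w \<and> i \<in> Compatible a \<and> mset i = M}.
        [:0, 1:] ^ (length i - len_D n w))"

section \<open>Specialization\<close>

text \<open>
  Both sides of the identity live in \<open>\<rat>((q\<^sup>-\<^sup>1))[[\<beta>]]\<close>: the power series variable is \<open>\<beta>\<close> and the
  Laurent series variable is \<open>q\<^sup>-\<^sup>1\<close>. Since \<^typ>\<open>rat fls\<close> is a field, a quotient of polynomials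
  in \<open>q\<close> computed there is its expansion as a Laurent series in \<open>q\<^sup>-\<^sup>1\<close>.
\<close>

type_synonym qseries = "rat fls fps"

definition q :: "rat fls" where
  "q = fls_X_inv"

text \<open>
  Sums of infinite families are taken coefficientwise; a family is summable if only
  finitely many members contribute to each coefficient and the result is again in the ring.
\<close>

definition has_formal_sum :: "('i \<Rightarrow> qseries) \<Rightarrow> 'i set \<Rightarrow> qseries \<Rightarrow> bool" where
  "has_formal_sum f I S \<longleftrightarrow>
     (\<forall>k e. finite {i \<in> I. fps_nth (f i) k $$ e \<noteq> 0} \<and>
            fps_nth S k $$ e = (\<Sum>i | i \<in> I \<and> fps_nth (f i) k $$ e \<noteq> 0. fps_nth (f i) k $$ e))"

definition formal_sum :: "('i \<Rightarrow> qseries) \<Rightarrow> 'i set \<Rightarrow> qseries" where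
  "formal_sum f I = (THE S. has_formal_sum f I S)"

definition poly_to_qseries :: "int poly \<Rightarrow> qseries" where
  "poly_to_qseries P = fps_of_poly (map_poly of_int P)"

definition specialize_term :: "xseries \<Rightarrow> int multiset \<Rightarrow> qseries" where
  "specialize_term F M = poly_to_qseries (F M) * fps_const (\<Prod>i\<in>#M. q powi (i - 1))"

definition specialize :: "xseries \<Rightarrow> qseries" where
  "specialize F = formal_sum (specialize_term F) UNIV"

section \<open>Primed words\<close>

datatype primed_letter = Primed (unprime: int) | Unprimed (unprime: int)

fun is_unprimed :: "primed_letter \<Rightarrow> bool" where
  "is_unprimed (Primed a) = False"
| "is_unprimed (Unprimed a) = True"

definition prec :: "primed_letter \<Rightarrow> primed_letter \<Rightarrow> bool" (infix \<open>\<prec>\<close> 50) where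
  "x \<prec> y \<longleftrightarrow>
     (unprime x < 0 \<and> 0 < unprime y) \<or>
     ((unprime x < 0 \<longleftrightarrow> unprime y < 0) \<and>
       (\<bar>unprime x\<bar> < \<bar>unprime y\<bar> \<or> (unprime x = unprime y \<and> \<not> is_unprimed x \<and> is_unprimed y)))"

definition PrimedHecke_D ::
  "nat \<Rightarrow> (int poly \<Rightarrow> 'h \<Rightarrow> 'h) \<Rightarrow> ((int \<Rightarrow> int) \<Rightarrow> 'h::ring_1) \<Rightarrow> (int \<Rightarrow> int) \<Rightarrow>
     primed_letter list set" where
  "PrimedHecke_D n scale \<pi> w = {a. map unprime a \<in> Hecke_D n scale \<pi> w}"

definition Sigma_D :: "primed_letter list \<Rightarrow> nat" where
  "Sigma_D a = (\<Sum>i | i < length a \<and> is_unprimed (a ! i). nat \<bar>unprime (a ! i)\<bar>)"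

text \<open>Positions in a word are counted from 1 in the second summand, whereas list indices start at 0.\<close>

definition comaj_D :: "primed_letter list \<Rightarrow> nat" where
  "comaj_D a = card {i. i < length a \<and> 0 < unprime (a ! i)} +
     (\<Sum>i | 1 \<le> i \<and> i < length a \<and> a ! (i - 1) \<prec> a ! i. 2 * i)"

section \<open>Well-definedness\<close>

lemma has_formal_sum_unique:
  assumes "has_formal_sum f I S" "has_formal_sum f I T"
  shows "S = T"
proof (rule fps_ext)
  fix k
  show "fps_nth S k = fps_nth T k"
    using assms unfolding has_formal_sum_def by (intro fls_eqI) metis
qed

lemma formal_sum_eqI: "has_formal_sum f I S \<Longrightarrow> formal_sum f I = S"
  unfolding formal_sum_def by (rule the_equality) (auto intro: has_formal_sum_unique)

lemma has_formal_sum_exists: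
  assumes fin: "\<And>k e. finite {i \<in> I. fps_nth (f i) k $$ e \<noteq> 0}"
    and bd: "\<And>k i e. i \<in> I \<Longrightarrow> e < b k \<Longrightarrow> fps_nth (f i) k $$ e = 0"
  shows "has_formal_sum f I (formal_sum f I)"
proof -
  define c where "c k e = (\<Sum>i | i \<in> I \<and> fps_nth (f i) k $$ e \<noteq> 0. fps_nth (f i) k $$ e)" for k e
  have c0: "c k e = 0" if "e < b k" for k e
    unfolding c_def using bd[OF _ that] by (intro sum.neutral) auto
  have nth: "Abs_fls (c k) $$ e = c k e" for k e
    by (rule nth_Abs_fls_lower_bound[of "b k"]) (use c0 in auto)
  have "has_formal_sum f I (Abs_fps (\<lambda>k. Abs_fls (c k)))"
    unfolding has_formal_sum_def using fin by (simp add: nth c_def)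
  then show ?thesis using formal_sum_eqI by metis
qed

lemma finite_letters: "finite (letters n)"
proof (rule finite_subset)
  show "letters n \<subseteq> {- int n..int n}" by (auto simp: letters_def)
qed simp

lemma finite_Groth_D_index:
  "finite {(a, i). a \<in> Hecke_D n scale \<pi> w \<and> i \<in> Compatible a \<and> mset i = M}"
proof (rule finite_subset)
  show "{(a, i). a \<in> Hecke_D n scale \<pi> w \<and> i \<in> Compatible a \<and> mset i = M}
      \<subseteq> {a. set a \<subseteq> letters n \<and> length a = size M} \<times> {i. mset i = M}"
    by (auto simp: Hecke_D_def Compatible_def)
  have "finite {i. mset i = M}"
  proof (rule finite_subset)
    show "{i. mset i = M} \<subseteq> {i. set i \<subseteq> set_mset M \<and> length i = size M}" by auto
  qed (intro finite_lists_length_eq finite_set_mset)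
  then show "finite ({a. set a \<subseteq> letters n \<and> length a = size M} \<times> {i. mset i = M})"
    by (intro finite_cartesian_product finite_lists_length_eq finite_letters)
qed

lemma Compatible_less:
  assumes "n \<ge> 1" "set a \<subseteq> letters n" "i \<in> Compatible a" "x \<in> set i"
  shows "x < int n"
proof -
  obtain j where j: "j < length i" "x = i ! j" using assms(4) by (auto simp: in_set_conv_nth)
  then have "a ! j \<in> letters n" "0 < x \<longrightarrow> x \<le> a ! j"
    using assms(2,3) by (auto simp: Compatible_def subset_iff)
  then show ?thesis using assms(1) by (auto simp: letters_def)
qed

text \<open>\<^const>\<open>Groth_D\<close> only involves the variables \<open>x\<^sub>i\<close> with \<open>i < n\<close>.\<close>

lemma Groth_D_variables:
  assumes "n \<ge> 1" "Groth_D n scale \<pi> w M \<noteq> 0"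
  shows "set_mset M \<subseteq> {..<int n}"
proof -
  have "{(a, i). a \<in> Hecke_D n scale \<pi> w \<and> i \<in> Compatible a \<and> mset i = M} \<noteq> {}"
    using assms(2) unfolding Groth_D_def by (metis sum.empty)
  then show ?thesis using Compatible_less[OF assms(1)] by (fastforce simp: Hecke_D_def)
qed

lemma coeff_Groth_D:
  assumes "coeff (Groth_D n scale \<pi> w M) k \<noteq> 0"
  shows "size M = k + len_D n w"
proof -
  obtain a i where ai: "a \<in> Hecke_D n scale \<pi> w" "i \<in> Compatible a" "mset i = M"
    "coeff ([:0, 1:] ^ (length i - len_D n w) :: int poly) k \<noteq> 0"
    using assms unfolding Groth_D_def coeff_sum by (auto elim!: sum.not_neutral_contains_not_neutral)
  then have "k = length i - len_D n w"
    by (metis coeff_monom monom_altdef mult_1 smult_1_left)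
  moreover have "len_D n w \<le> length i" using ai by (auto simp: Hecke_D_def Compatible_def)
  ultimately show ?thesis using ai by auto
qed

lemma q_powi_nth: "(q powi m) $$ e = (if e = - m then 1 else 0)"
proof (cases "m \<ge> 0")
  case True
  then show ?thesis by (simp add: power_int_def q_def)
next
  case False
  have "inverse q = fls_X" unfolding q_def by (metis fls_inverse_X inverse_inverse_eq)
  with False show ?thesis by (auto simp: power_int_def fls_X_power_nth)
qed

lemma prod_q: "(\<Prod>i\<in>#M. q powi (i - 1)) = q powi (\<Sum>i\<in>#M. i - 1)"
  by (induction M) (auto simp: power_int_add q_def)

lemma specialize_term_nth:
  "fps_nth (specialize_term F M) k $$ e =
     (if e = - (\<Sum>i\<in>#M. i - 1) then of_int (coeff (F M) k) else 0)"
  by (simp add: specialize_term_def poly_to_qseries_def prod_q fps_mult_right_const_nth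
      coeff_map_poly fls_of_int fls_mult_const_nth q_powi_nth)

lemma specialize_Groth_D_summable:
  assumes "n \<ge> 1"
  shows "has_formal_sum (specialize_term (Groth_D n scale \<pi> w)) UNIV (specialize (Groth_D n scale \<pi> w))"
  unfolding specialize_def
proof (rule has_formal_sum_exists)
  let ?t = "specialize_term (Groth_D n scale \<pi> w)"
  have *: "size M = k + len_D n w \<and> set_mset M \<subseteq> {..<int n} \<and> e = - (\<Sum>i\<in>#M. i - 1)"
    if "fps_nth (?t M) k $$ e \<noteq> 0" for M k e
  proof -
    have nz: "coeff (Groth_D n scale \<pi> w M) k \<noteq> 0" and e: "e = - (\<Sum>i\<in>#M. i - 1)"
      using that by (auto simp: specialize_term_nth split: if_splits)
    from nz have "Groth_D n scale \<pi> w M \<noteq> 0" by auto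
    with nz e show ?thesis using coeff_Groth_D Groth_D_variables[OF assms] by blast
  qed
  have bound: "(\<Sum>i\<in>#M. i - 1) \<le> int (size M) * int n" if "set_mset M \<subseteq> {..<int n}" for M
    using that by (induction M) (auto simp: algebra_simps)
  have lower: "(\<Sum>i\<in>#M. i - 1) - int (size M) * int n \<le> x - 1"
    if M: "set_mset M \<subseteq> {..<int n}" and x: "x \<in># M" for M x
  proof -
    obtain N where N: "M = add_mset x N" using x by (metis multi_member_split)
    with M have "(\<Sum>i\<in>#N. i - 1) \<le> int (size N) * int n" by (intro bound) auto
    then show ?thesis by (simp add: N algebra_simps)
  qed
  show "fps_nth (?t M) k $$ e = 0" if "e < - (int (k + len_D n w) * int n)" for M k e
    using *[of M k e] bound[of M] that by fastforce
  show "finite {M \<in> UNIV. fps_nth (?t M) k $$ e \<noteq> 0}" for k e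
  proof (rule finite_subset)
    let ?p = "k + len_D n w"
    let ?A = "{1 - e - int ?p * int n..<int n}"
    show "{M \<in> UNIV. fps_nth (?t M) k $$ e \<noteq> 0} \<subseteq> mset ` {xs. set xs \<subseteq> ?A \<and> length xs = ?p}"
    proof
      fix M assume "M \<in> {M \<in> UNIV. fps_nth (?t M) k $$ e \<noteq> 0}"
      then have M: "size M = ?p" "set_mset M \<subseteq> {..<int n}" "e = - (\<Sum>i\<in>#M. i - 1)"
        using *[of M k e] by auto
      obtain xs where xs: "M = mset xs" by (metis ex_mset)
      have "x \<in> ?A" if "x \<in># M" for x
        using lower[OF M(2) that] M that by auto
      then show "M \<in> mset ` {xs. set xs \<subseteq> ?A \<and> length xs = ?p}"
        using xs M(1) by auto
    qed
    show "finite (mset ` {xs. set xs \<subseteq> ?A \<and> length xs = ?p})"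
      by (intro finite_imageI finite_lists_length_eq) simp
  qed
qed

lemma PrimedHecke_D_summable:
  fixes c :: "primed_letter list \<Rightarrow> rat fls" and n :: nat and w :: "int \<Rightarrow> int"
  defines "f \<equiv> \<lambda>a. fps_X ^ (length a - len_D n w) * fps_const (c a)"
  shows "has_formal_sum f (PrimedHecke_D n scale \<pi> w) (formal_sum f (PrimedHecke_D n scale \<pi> w))"
proof (rule has_formal_sum_exists)
  let ?P = "PrimedHecke_D n scale \<pi> w"
  define A where "A k = {a. set a \<subseteq> Primed ` letters n \<union> Unprimed ` letters n \<and> length a = k + len_D n w}" for k
  have A: "finite (A k)" for k
    unfolding A_def by (intro finite_lists_length_eq finite_UnI finite_imageI finite_letters)
  have nth: "fps_nth (f a) k = (if k = length a - len_D n w then c a else 0)" for a k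
    by (simp add: f_def fps_mult_right_const_nth)
  have *: "a \<in> A k" if "a \<in> ?P" "fps_nth (f a) k $$ e \<noteq> 0" for a k e
  proof -
    have "k = length a - len_D n w" using that(2) by (auto simp: nth split: if_splits)
    moreover have "len_D n w \<le> length a" and l: "unprime ` set a \<subseteq> letters n"
      using that(1) by (auto simp: PrimedHecke_D_def Hecke_D_def)
    moreover have "x \<in> Primed ` letters n \<union> Unprimed ` letters n" if "x \<in> set a" for x
      using l that by (cases x) force+
    ultimately show ?thesis by (auto simp: A_def)
  qed
  show "finite {a \<in> ?P. fps_nth (f a) k $$ e \<noteq> 0}" for k e
    by (rule finite_subset[OF _ A[of k]]) (use * in auto)
  define b where "b k = Min (insert 0 ((\<lambda>a. fls_subdegree (c a)) ` A k))" for k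
  show "fps_nth (f a) k $$ e = 0" if "a \<in> ?P" "e < b k" for a k e
  proof (rule ccontr)
    assume nz: "fps_nth (f a) k $$ e \<noteq> 0"
    then have "b k \<le> fls_subdegree (c a)"
      unfolding b_def using A[of k] *[OF that(1) nz] by (intro Min_le) auto
    moreover have "fls_subdegree (c a) \<le> e"
      using nz by (intro fls_subdegree_leI) (auto simp: nth split: if_splits)
    ultimately show False using that(2) by simp
  qed
qed

end

theory Submission
  imports Defs
begin

text \<open>
  Put \<open>h\<^sub>a(x) = 1 + x \<pi>\<^sub>a\<close>, \<open>B(x) = h\<^bsub>n-1\<^esub>(x) \<cdots> h\<^sub>1(x) h\<^bsub>-1\<^esub>(x) \<cdots> h\<^bsub>-(n-1)\<^esub>(x)\<close> and
  \<open>A\<^sub>j(x) = h\<^bsub>n-1\<^esub>(x) \<cdots> h\<^sub>j(x)\<close>. Reading off compatible sequences level by level, the left side is the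
  coefficient of \<open>\<pi>\<^sub>w\<close> in \<open>\<cdots> B(q\<^sup>-\<^sup>2) B(q\<^sup>-\<^sup>1) A\<^sub>1(1) A\<^sub>2(q) \<cdots> A\<^bsub>n-1\<^esub>(q\<^bsup>n-2\<^esup>)\<close>. Expanding the geometric series
  turns the right side into the coefficient of \<open>\<pi>\<^sub>w\<close> in \<open>\<cdots> C(q\<^sup>-\<^sup>4) C(q\<^sup>-\<^sup>2)\<close>, where \<open>C(x)\<close> is the product of all
  \<open>h\<^bsub>-j\<^esub>(x) h\<^bsub>-j\<^esub>(x q\<^sup>j)\<close> followed by all \<open>h\<^sub>j(x q) h\<^sub>j(x q\<^bsup>j+1\<^esup>)\<close>. The Yang--Baxter equation gives, for arbitrary
  parameters \<open>x\<^sub>i\<close>,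
  \<open>B(x\<^sub>0) B(x\<^sub>1) A\<^sub>1(x\<^sub>2) \<cdots> A\<^bsub>n-1\<^esub>(x\<^sub>n) = A\<^sub>1(x\<^sub>0) \<cdots> A\<^bsub>n-1\<^esub>(x\<^bsub>n-2\<^esub>) \<Prod>\<^sub>j h\<^bsub>-j\<^esub>(x\<^sub>0) h\<^bsub>-j\<^esub>(x\<^sub>j) \<Prod>\<^sub>j h\<^sub>j(x\<^sub>1) h\<^sub>j(x\<^bsub>j+1\<^esub>)\<close>.
  With \<open>x\<^sub>i = q\<^bsup>i-2k\<^esup>\<close> this is iterated \<open>K\<close> times, and the factors \<open>A\<^sub>j\<close>, pushed to the far left, tend to 1 as
  \<open>K\<close> grows.
\<close>

section \<open>Yang--Baxter identities\<close>

text \<open>The Dynkin diagram of type D in signed letters: \<open>a\<close> and \<open>-a\<close>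
  name the same node when |a| >= 2, while 1 and -1 are distinct nonadjacent nodes, both joined to 2.
  Absolute values therefore decide adjacency.\<close>

definition adj :: "int \<Rightarrow> int \<Rightarrow> bool" where
  "adj a b \<longleftrightarrow> \<bar>\<bar>a\<bar> - \<bar>b\<bar>\<bar> = 1"

text \<open>Functions constant on the classes of the 0-Hecke monoid of type D. As test functions
  they allow identities between products to be stated on words alone.\<close>

definition Hecke_invariant :: "nat \<Rightarrow> (int list \<Rightarrow> 'k) \<Rightarrow> bool" where
  "Hecke_invariant n f \<longleftrightarrow>
     (\<forall>u v. \<forall>a \<in> letters n.
        f (u @ [a, a] @ v) = f (u @ [a] @ v) \<and>
        (2 \<le> \<bar>a\<bar> \<longrightarrow> f (u @ [- a] @ v) = f (u @ [a] @ v)) \<and>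
        (\<forall>b \<in> letters n.
          (\<not> adj a b \<longrightarrow> f (u @ [a, b] @ v) = f (u @ [b, a] @ v)) \<and>
          (adj a b \<longrightarrow> f (u @ [a, b, a] @ v) = f (u @ [b, a, b] @ v))))"

text \<open>\<open>factors x [(a\<^sub>1, i\<^sub>1), \<dots>] f []\<close> pairs \<open>f\<close> with the product \<open>(1 + x i\<^sub>1 T\<^bsub>a\<^sub>1\<^esub>) \<cdots>\<close>, where \<open>T\<^sub>a\<close> acts on
  functions of words by \<open>(T\<^sub>a f) u = f (u @ [a])\<close>. On invariant functions the \<open>T\<^sub>a\<close> satisfy the relations
  of the algebra with \<open>\<beta> = 1\<close>; the powers of \<open>\<beta>\<close> are put into the weights \<open>x\<close>.\<close>

fun factors :: "('i \<Rightarrow> 'k::comm_ring_1) \<Rightarrow> (int \<times> 'i) list \<Rightarrow> (int list \<Rightarrow> 'k) \<Rightarrow> int list \<Rightarrow> 'k" where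
  "factors x [] f u = f u"
| "factors x (e # es) f u = factors x es f u + x (snd e) * factors x es f (u @ [fst e])"

definition factors_equiv :: "nat \<Rightarrow> ('i \<Rightarrow> 'k::comm_ring_1) \<Rightarrow> (int \<times> 'i) list \<Rightarrow> (int \<times> 'i) list \<Rightarrow> bool" where
  "factors_equiv n x es es' \<longleftrightarrow> (\<forall>f. Hecke_invariant n f \<longrightarrow> factors x es f = factors x es' f)"

lemma factors_append: "factors x (es @ es') f = factors x es (factors x es' f)"
proof
  show "factors x (es @ es') f u = factors x es (factors x es' f) u" for u
    by (induction es arbitrary: u) auto
qed

lemma Hecke_invariantD:
  assumes "Hecke_invariant n f" "a \<in> letters n"
  shows "f (u @ a # a # v) = f (u @ a # v)"
    and "2 \<le> \<bar>a\<bar> \<Longrightarrow> f (u @ (- a) # v) = f (u @ a # v)"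
    and "b \<in> letters n \<Longrightarrow> \<not> adj a b \<Longrightarrow> f (u @ a # b # v) = f (u @ b # a # v)"
    and "b \<in> letters n \<Longrightarrow> adj a b \<Longrightarrow> f (u @ a # b # a # v) = f (u @ b # a # b # v)"
  using assms by (auto simp: Hecke_invariant_def)

text \<open>The operators only append letters on the right, so a relation inside the prefix
  survives. This is what lets an identity be used in the middle of a longer product.\<close>

lemma Hecke_invariant_factors:
  assumes "Hecke_invariant n f"
  shows "Hecke_invariant n (factors x es f)"
proof (induction es)
  case Nil
  have "factors x [] f = f" by auto
  then show ?case using assms by simp
next
  case (Cons e es)
  show ?case
    unfolding Hecke_invariant_def
  proof (intro allI ballI conjI impI)
    fix u v a b assume a: "a \<in> letters n" and b: "b \<in> letters n"
    note D = Hecke_invariantD[OF Cons a, where u = u]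
    show "factors x (e # es) f (u @ [a, a] @ v) = factors x (e # es) f (u @ [a] @ v)"
      using D(1)[of v] D(1)[of "v @ [fst e]"] by simp
    show "factors x (e # es) f (u @ [- a] @ v) = factors x (e # es) f (u @ [a] @ v)" if "2 \<le> \<bar>a\<bar>"
      using D(2)[OF that, of v] D(2)[OF that, of "v @ [fst e]"] by simp
    show "factors x (e # es) f (u @ [a, b] @ v) = factors x (e # es) f (u @ [b, a] @ v)" if "\<not> adj a b"
      using D(3)[OF b that, of v] D(3)[OF b that, of "v @ [fst e]"] by simp
    show "factors x (e # es) f (u @ [a, b, a] @ v) = factors x (e # es) f (u @ [b, a, b] @ v)" if "adj a b"
      using D(4)[OF b that, of v] D(4)[OF b that, of "v @ [fst e]"] by simp
  qed
qed

lemma factors_equiv_refl [simp]: "factors_equiv n x es es"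
  by (simp add: factors_equiv_def)

lemma factors_equiv_sym: "factors_equiv n x es es' \<Longrightarrow> factors_equiv n x es' es"
  by (simp add: factors_equiv_def)

lemma factors_equiv_trans [trans]:
  "factors_equiv n x es es' \<Longrightarrow> factors_equiv n x es' es'' \<Longrightarrow> factors_equiv n x es es''"
  by (simp add: factors_equiv_def)

lemma factors_equiv_append:
  "factors_equiv n x es es' \<Longrightarrow> factors_equiv n x ds ds' \<Longrightarrow> factors_equiv n x (es @ ds) (es' @ ds')"
  by (simp add: factors_equiv_def factors_append Hecke_invariant_factors)

lemma factors_equiv_concat:
  assumes "\<And>i. i \<in> set is \<Longrightarrow> factors_equiv n x (F i) (G i)"
  shows "factors_equiv n x (concat (map F is)) (concat (map G is))"
  using assms by (induction "is") (auto intro: factors_equiv_append)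

lemma factors_equiv_commute:
  assumes "a \<in> letters n" "b \<in> letters n" "\<not> adj a b"
  shows "factors_equiv n x [(a, i), (b, j)] [(b, j), (a, i)]"
  unfolding factors_equiv_def
proof (intro allI impI ext)
  fix f :: "int list \<Rightarrow> 'b" and u assume "Hecke_invariant n f"
  from Hecke_invariantD(3)[OF this assms(1,2,3), of u "[]"]
  show "factors x [(a, i), (b, j)] f u = factors x [(b, j), (a, i)] f u"
    by (simp add: algebra_simps)
qed

lemma factors_equiv_uminus:
  assumes "a \<in> letters n" "2 \<le> \<bar>a\<bar>"
  shows "factors_equiv n x [(- a, i)] [(a, i)]"
  unfolding factors_equiv_def
  using Hecke_invariantD(2)[OF _ assms, of _ _ "[]"] by fastforce

text \<open>With h_a(x) = 1 + x T_a one has h_a(x) h_a(y) = h_a(x + y + x y), so this is the usual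
  h_a(x) h_b(x+y+xy) h_a(y) = h_b(y) h_a(x+y+xy) h_b(x).\<close>

lemma factors_equiv_Yang_Baxter:
  assumes "a \<in> letters n" "b \<in> letters n" "adj a b"
  shows "factors_equiv n x [(a, i), (b, i), (b, j), (a, j)] [(b, j), (a, i), (a, j), (b, i)]"
  unfolding factors_equiv_def
proof (intro allI impI ext)
  fix f :: "int list \<Rightarrow> 'b" and u assume f: "Hecke_invariant n f"
  \<comment> \<open>All words in the expansion reduce to six reduced words in \<open>a\<close> and
    \<open>b\<close>: the empty word, a, b, ab, ba and aba.\<close>
  have [simp]: "f (u @ [a, a]) = f (u @ [a])" "f (u @ [b, b]) = f (u @ [b])"
    "f (u @ [a, a, b]) = f (u @ [a, b])" "f (u @ [b, b, a]) = f (u @ [b, a])"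
    "f (u @ [a, b, b]) = f (u @ [a, b])" "f (u @ [b, a, a]) = f (u @ [b, a])"
    "f (u @ [a, b, b, a]) = f (u @ [a, b, a])" "f (u @ [b, a, a, b]) = f (u @ [a, b, a])"
    "f (u @ [b, a, b]) = f (u @ [a, b, a])"
    using Hecke_invariantD(1)[OF f assms(1), of u "[]"] Hecke_invariantD(1)[OF f assms(2), of u "[]"]
     Hecke_invariantD(1)[OF f assms(1), of u "[b]"] Hecke_invariantD(1)[OF f assms(2), of u "[a]"]
     Hecke_invariantD(1)[OF f assms(1), of "u @ [b]" "[]"] Hecke_invariantD(1)[OF f assms(2), of "u @ [a]" "[]"]
     Hecke_invariantD(1)[OF f assms(1), of "u @ [b]" "[b]"] Hecke_invariantD(1)[OF f assms(2), of "u @ [a]" "[a]"]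
     Hecke_invariantD(4)[OF f assms, of u "[]"]
    by simp_all
  show "factors x [(a, i), (b, i), (b, j), (a, j)] f u = factors x [(b, j), (a, i), (a, j), (b, i)] f u"
    by (simp add: algebra_simps)
qed

lemma factors_equiv_commute_list:
  assumes "a \<in> letters n" "\<And>e. e \<in> set es \<Longrightarrow> fst e \<in> letters n \<and> \<not> adj a (fst e)"
  shows "factors_equiv n x ((a, i) # es) (es @ [(a, i)])"
  using assms(2)
proof (induction es)
  case (Cons e es)
  have "factors_equiv n x ([(a, i), (fst e, snd e)] @ es) ([(fst e, snd e), (a, i)] @ es)"
    using Cons.prems by (intro factors_equiv_append factors_equiv_commute assms(1)) auto
  moreover have "factors_equiv n x ([e] @ (a, i) # es) ([e] @ es @ [(a, i)])"
    using Cons by (intro factors_equiv_append) auto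
  ultimately show ?case using factors_equiv_trans by fastforce
qed simp

section \<open>Rising and falling products along a chain of letters\<close>

definition up :: "(int \<Rightarrow> int) \<Rightarrow> int \<Rightarrow> int \<Rightarrow> 'i \<Rightarrow> (int \<times> 'i) list" where
  "up g N k i = map (\<lambda>j. (g j, i)) [k..N]"

definition down :: "(int \<Rightarrow> int) \<Rightarrow> int \<Rightarrow> int \<Rightarrow> 'i \<Rightarrow> (int \<times> 'i) list" where
  "down g N k i = rev (up g N k i)"

lemma up_Cons: "k \<le> N \<Longrightarrow> up g N k i = (g k, i) # up g N (k + 1) i"
  by (simp add: up_def upto_rec1)

lemma up_empty [simp]: "N < k \<Longrightarrow> up g N k i = []" by (simp add: up_def)

lemma down_snoc: "k \<le> N \<Longrightarrow> down g N k i = down g N (k + 1) i @ [(g k, i)]"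
  by (simp add: down_def up_Cons)

lemma down_empty [simp]: "N < k \<Longrightarrow> down g N k i = []" by (simp add: down_def)

lemma set_up: "set (up g N k i) = (\<lambda>j. (g j, i)) ` {k..N}"
  by (auto simp: up_def)

lemma set_down: "set (down g N k i) = (\<lambda>j. (g j, i)) ` {k..N}"
  by (simp add: down_def set_up)

text \<open>The diagram of type D contains two long type A chains, 1, 2, ..., n-1 and -1, 2, ...,
  n-1; both are treated at once.\<close>

locale type_A_chain =
  fixes n :: nat and g :: "int \<Rightarrow> int" and N l :: int
  assumes letter: "l \<le> j \<Longrightarrow> j \<le> N \<Longrightarrow> g j \<in> letters n"
    and adjacent: "l \<le> j \<Longrightarrow> j < N \<Longrightarrow> adj (g j) (g (j + 1))"
    and nonadjacent: "l \<le> j \<Longrightarrow> j + 1 < k \<Longrightarrow> k \<le> N \<Longrightarrow> \<not> adj (g j) (g k)"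
begin

text \<open>Induction on \<open>N - k\<close>: the inner exchange produces a pair of factors at
  \<open>g (k + 1)\<close>, the outer factors at \<open>g k\<close> commute up to this pair, and
  Yang-Baxter turns the four around.\<close>

lemma up_down:
  assumes "l \<le> k" "k \<le> N"
  shows "factors_equiv n x (up g N k i @ down g N k j)
           (down g N (k + 1) j @ [(g k, i), (g k, j)] @ up g N (k + 1) i)"
  using assms
proof (induction "nat (N - k)" arbitrary: k)
  case 0
  then show ?case by (simp add: up_Cons down_snoc)
next
  case (Suc m)
  then have k: "k < N" by simp
  let ?u = "\<lambda>t. up g N (k + t) i" and ?d = "\<lambda>t. down g N (k + t) j"
  have *: "\<And>y. y \<in> set (?u 2) \<union> set (?d 2) \<Longrightarrow> fst y \<in> letters n \<and> \<not> adj (g k) (fst y)"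
    using Suc.prems letter nonadjacent by (auto simp: set_up set_down)
  have gk: "g k \<in> letters n" using letter Suc.prems by simp
  have IH: "factors_equiv n x (?u 1 @ ?d 1) (?d 2 @ [(g (k + 1), i), (g (k + 1), j)] @ ?u 2)"
    using Suc(1)[of "k + 1"] Suc(2-) by (simp add: add.assoc)
  have "up g N k i @ down g N k j = [(g k, i)] @ (?u 1 @ ?d 1) @ [(g k, j)]"
    using k by (simp add: up_Cons down_snoc)
  also have "factors_equiv n x \<dots> ([(g k, i)] @ (?d 2 @ [(g (k + 1), i), (g (k + 1), j)] @ ?u 2) @ [(g k, j)])"
    by (intro factors_equiv_append factors_equiv_refl IH)
  also have "\<dots> = ((g k, i) # ?d 2) @ [(g (k + 1), i), (g (k + 1), j)] @ ?u 2 @ [(g k, j)]"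
    by simp
  also have "factors_equiv n x \<dots> ((?d 2 @ [(g k, i)]) @ [(g (k + 1), i), (g (k + 1), j)] @ (g k, j) # ?u 2)"
    using * by (intro factors_equiv_append factors_equiv_refl factors_equiv_commute_list
       factors_equiv_sym[OF factors_equiv_commute_list] gk) auto
  also have "\<dots> = ?d 2 @ [(g k, i), (g (k + 1), i), (g (k + 1), j), (g k, j)] @ ?u 2" by simp
  also have "factors_equiv n x \<dots> (?d 2 @ [(g (k + 1), j), (g k, i), (g k, j), (g (k + 1), i)] @ ?u 2)"
    using k Suc.prems letter adjacent
    by (intro factors_equiv_append factors_equiv_refl factors_equiv_Yang_Baxter) auto
  also have "\<dots> = ?d 1 @ [(g k, i), (g k, j)] @ ?u 1"
    using k by (simp add: up_Cons down_snoc add.assoc)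
  finally show ?case .
qed

text \<open>Crossing one falling product by \<open>up_down\<close> releases a pair at
  \<open>g k\<close> and shortens both products. The pair then commutes past the remaining shortened
  falling products, whose letters start at \<open>g (k + 2)\<close>.\<close>

lemma up_staircase:
  assumes "l \<le> k"
  shows "factors_equiv n x
     (up g N k i @ concat (map (\<lambda>j. down g N j (X j)) [k..N]))
     (concat (map (\<lambda>j. down g N (j + 1) (X j)) [k..N]) @ concat (map (\<lambda>j. [(g j, i), (g j, X j)]) [k..N]))"
  using assms
proof (induction "nat (N + 1 - k)" arbitrary: k)
  case 0
  then show ?case by simp
next
  case (Suc m)
  then have k: "k \<le> N" by simp
  let ?S = "\<lambda>k. concat (map (\<lambda>j. down g N j (X j)) [k..N])"
  let ?T = "\<lambda>k. concat (map (\<lambda>j. down g N (j + 1) (X j)) [k..N])"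
  let ?Y = "\<lambda>k. concat (map (\<lambda>j. [(g j, i), (g j, X j)]) [k..N])"
  have gk: "g k \<in> letters n" using letter Suc.prems k by simp
  have *: "fst y \<in> letters n \<and> \<not> adj (g k) (fst y)" if y: "y \<in> set (?T (k + 1))" for y
    using y letter nonadjacent Suc.prems by (auto simp: set_down)
  have "up g N k i @ ?S k = (up g N k i @ down g N k (X k)) @ ?S (k + 1)"
    using k by (simp add: upto_rec1)
  also have "factors_equiv n x \<dots> ((down g N (k + 1) (X k) @ [(g k, i), (g k, X k)] @ up g N (k + 1) i) @ ?S (k + 1))"
    using k Suc.prems by (intro factors_equiv_append factors_equiv_refl up_down)
  also have "\<dots> = (down g N (k + 1) (X k) @ [(g k, i), (g k, X k)]) @ (up g N (k + 1) i @ ?S (k + 1))" by simp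
  also have "factors_equiv n x \<dots> ((down g N (k + 1) (X k) @ [(g k, i), (g k, X k)]) @ ?T (k + 1) @ ?Y (k + 1))"
    using Suc by (intro factors_equiv_append factors_equiv_refl Suc(1)) auto
  also have "\<dots> = (down g N (k + 1) (X k) @ [(g k, i)]) @ ((g k, X k) # ?T (k + 1)) @ ?Y (k + 1)" by simp
  also have "factors_equiv n x \<dots> ((down g N (k + 1) (X k) @ [(g k, i)]) @ (?T (k + 1) @ [(g k, X k)]) @ ?Y (k + 1))"
    using * by (intro factors_equiv_append factors_equiv_refl factors_equiv_commute_list gk)
  also have "\<dots> = down g N (k + 1) (X k) @ ((g k, i) # ?T (k + 1)) @ [(g k, X k)] @ ?Y (k + 1)" by simp
  also have "factors_equiv n x \<dots> (down g N (k + 1) (X k) @ (?T (k + 1) @ [(g k, i)]) @ [(g k, X k)] @ ?Y (k + 1))"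
    using * by (intro factors_equiv_append factors_equiv_refl factors_equiv_commute_list gk)
  also have "\<dots> = ?T k @ ?Y k" using k by (simp add: upto_rec1)
  finally show ?case .
qed

end

section \<open>The type D factorization\<close>

definition B_factor :: "nat \<Rightarrow> int \<Rightarrow> (int \<times> int) list" where
  "B_factor n i = down id (int n - 1) 1 i @ up uminus (int n - 1) 1 i"

text \<open>The product A_1(x_{s+1}) A_2(x_{s+2}) ... of the overview. Shift 0 is the part of the
  left side with positive indices; negative shifts are the remainder pushed to the left.\<close>

definition staircase :: "nat \<Rightarrow> int \<Rightarrow> (int \<times> int) list" where
  "staircase n s = concat (map (\<lambda>j. down id (int n - 1) j (j + s)) [1..int n - 1])"

text \<open>Lets a full falling product absorb a staircase of shortened ones.
  \<open>F (N + 1)\<close> is the extra last term of the shifted list.\<close>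

lemma concat_map_upto_shift:
  assumes "k \<le> N + 1" "F (N + 1) = []"
  shows "F k @ concat (map (\<lambda>j. F (j + 1)) [k..N]) = concat (map F [k..N])"
  using assms(1)
proof (induction "nat (N + 1 - k)" arbitrary: k)
  case 0
  then have "k = N + 1" by simp
  then show ?case using assms(2) by simp
next
  case (Suc m)
  then have "F (k + 1) @ concat (map (\<lambda>j. F (j + 1)) [k + 1..N]) = concat (map F [k + 1..N])"
    by simp
  then show ?case using Suc by (simp add: upto_rec1)
qed

lemma type_A_chain_id: "type_A_chain n id (int n - 1) 1"
  by unfold_locales (auto simp: adj_def letters_def)

abbreviation twist :: "int \<Rightarrow> int" where
  "twist j \<equiv> if j = 1 then - 1 else j"

lemma type_A_chain_twist: "type_A_chain n twist (int n - 1) 1"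
  by unfold_locales (auto simp: adj_def letters_def)

lemma up_twist: "1 < k \<Longrightarrow> up twist N k i = up id N k i"
  by (auto simp: up_def)

lemma down_twist: "1 < k \<Longrightarrow> down twist N k i = down id N k i"
  by (simp add: down_def up_twist)

lemma factors_equiv_twist:
  assumes "1 \<le> j" "j \<le> int n - 1"
  shows "factors_equiv n x [(twist j, i)] [(- j, i)]"
proof (cases "j = 1")
  case False
  then show ?thesis
    using assms factors_equiv_sym[OF factors_equiv_uminus[of j n x i]] by (auto simp: letters_def)
qed simp

text \<open>For j >= 2 the letters -j and j are interchangeable, so the negative half of
  \<open>B_factor\<close> runs along the chain -1, 2, ..., n-1.\<close>

lemma up_twist_uminus: "factors_equiv n x (up uminus (int n - 1) 1 i) (up twist (int n - 1) 1 i)"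
proof -
  have up: "up g N k i = concat (map (\<lambda>j. [(g j, i)]) [k..N])" for g N k
    by (simp add: up_def)
  show ?thesis
    unfolding up by (intro factors_equiv_concat factors_equiv_sym[OF factors_equiv_twist]) auto
qed

lemma B_factor_up_twist:
  "factors_equiv n x (B_factor n i) (down id (int n - 1) 1 i @ up twist (int n - 1) 1 i)"
  unfolding B_factor_def by (intro factors_equiv_append factors_equiv_refl up_twist_uminus)

text \<open>The letters 1 and -1 commute and sit side by side in the middle, so the two chains may
  swap roles between the falling and the rising half.\<close>

lemma B_factor_twist:
  "factors_equiv n x (B_factor n i) (down twist (int n - 1) 1 i @ up id (int n - 1) 1 i)"
proof (cases "n \<le> 1")
  case True
  then show ?thesis by (simp add: B_factor_def)
next
  case False
  let ?N = "int n - 1"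
  from False have N: "1 \<le> ?N" by simp
  have "factors_equiv n x (B_factor n i) (down id ?N 1 i @ up twist ?N 1 i)"
    by (rule B_factor_up_twist)
  also have "\<dots> = down id ?N 2 i @ [(1, i), (- 1, i)] @ up id ?N 2 i"
    using N by (simp add: down_snoc up_Cons up_twist)
  also have "factors_equiv n x \<dots> (down id ?N 2 i @ [(- 1, i), (1, i)] @ up id ?N 2 i)"
    using N by (intro factors_equiv_append factors_equiv_refl factors_equiv_commute)
      (auto simp: letters_def adj_def)
  also have "\<dots> = down twist ?N 1 i @ up id ?N 1 i"
    using N by (simp add: down_snoc up_Cons down_twist)
  finally show ?thesis .
qed

text \<open>Writing the two \<open>B_factor\<close>s in opposite forms makes both halves between
  them run along \<open>twist\<close>. The rising products enter the staircase one after the other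
  by \<open>up_staircase\<close>, each releasing a row of pairs. Each time the shortened staircase,
  free of the letter 1 and hence common to both chains, absorbs the falling product in front of it,
  and its shift drops by one.\<close>

lemma B_factor_staircase:
  assumes "n \<ge> 1"
  shows "factors_equiv n x (B_factor n i @ B_factor n (i + 1) @ staircase n (i + 1))
     (staircase n (i - 1) @ concat (map (\<lambda>j. [(- j, i), (- j, j + i)]) [1..int n - 1]) @
      concat (map (\<lambda>j. [(j, i + 1), (j, j + (i + 1))]) [1..int n - 1]))"
proof -
  let ?N = "int n - 1"
  let ?E = "\<lambda>g i. concat (map (\<lambda>j. [(g j, i), (g j, j + i)]) [1..?N])"
  let ?T = "\<lambda>g i. concat (map (\<lambda>j. down g ?N (j + 1) (j + i)) [1..?N])"
  let ?S = "\<lambda>g i. concat (map (\<lambda>j. down g ?N j (j + i)) [1..?N])"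
  have S_T: "down g ?N 1 (1 + i) @ concat (map (\<lambda>j. down g ?N (j + 1) (j + 1 + i)) [1..?N]) = ?S g i" for g i
    using concat_map_upto_shift[of 1 ?N "\<lambda>j. down g ?N j (j + i)"] assms by simp
  have T_twist: "?T twist i = ?T id i" for i
    by (intro arg_cong[of _ _ concat] map_cong) (auto simp: down_twist)
  have E_twist: "factors_equiv n x (?E twist i) (?E uminus i)"
  proof (intro factors_equiv_concat)
    fix j assume "j \<in> set [1..?N]"
    then have "factors_equiv n x ([(twist j, i)] @ [(twist j, j + i)]) ([(- j, i)] @ [(- j, j + i)])"
      by (intro factors_equiv_append factors_equiv_twist) auto
    then show "factors_equiv n x [(twist j, i), (twist j, j + i)] [(- j, i), (- j, j + i)]" by simp
  qed
  have "factors_equiv n x (B_factor n i @ B_factor n (i + 1) @ staircase n (i + 1))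
     ((down id ?N 1 i @ up twist ?N 1 i) @ (down twist ?N 1 (i + 1) @ up id ?N 1 (i + 1)) @ ?S id (i + 1))"
    unfolding staircase_def
    by (intro factors_equiv_append factors_equiv_refl B_factor_twist B_factor_up_twist)
  also have "\<dots> = (down id ?N 1 i @ up twist ?N 1 i @ down twist ?N 1 (i + 1)) @ (up id ?N 1 (i + 1) @ ?S id (i + 1))"
    by simp
  also have "factors_equiv n x \<dots> ((down id ?N 1 i @ up twist ?N 1 i @ down twist ?N 1 (i + 1)) @
      (?T id (i + 1) @ ?E id (i + 1)))"
    by (intro factors_equiv_append[OF factors_equiv_refl type_A_chain.up_staircase[OF type_A_chain_id]]) simp
  also have "\<dots> = down id ?N 1 i @ (up twist ?N 1 i @
      (down twist ?N 1 (1 + i) @ concat (map (\<lambda>j. down twist ?N (j + 1) (j + 1 + i)) [1..?N]))) @ ?E id (i + 1)"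
    unfolding T_twist[symmetric] by (simp add: ac_simps)
  also have "\<dots> = down id ?N 1 i @ (up twist ?N 1 i @ ?S twist i) @ ?E id (i + 1)"
    unfolding S_T ..
  also have "factors_equiv n x \<dots> (down id ?N 1 i @ (?T twist i @ ?E twist i) @ ?E id (i + 1))"
    by (intro factors_equiv_append[OF factors_equiv_refl factors_equiv_append[OF _ factors_equiv_refl]]
          type_A_chain.up_staircase[OF type_A_chain_twist]) simp
  also have "factors_equiv n x \<dots> (down id ?N 1 i @ (?T twist i @ ?E uminus i) @ ?E id (i + 1))"
    by (intro factors_equiv_append factors_equiv_refl E_twist)
  also have "down id ?N 1 i @ (?T twist i @ ?E uminus i) @ ?E id (i + 1) =
      staircase n (i - 1) @ ?E uminus i @ ?E id (i + 1)"
    using S_T[of id "i - 1"] unfolding T_twist by (simp add: staircase_def)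
  finally show ?thesis by simp
qed

text \<open>The letters are listed in increasing order for \<open>\<prec>\<close>, so that choosing
  factors means choosing a strictly increasing word.\<close>

definition C_factor :: "nat \<Rightarrow> int \<Rightarrow> (primed_letter \<times> int) list" where
  "C_factor n m =
     concat (map (\<lambda>j. [(Primed (- j), m), (Unprimed (- j), m)]) [1..int n - 1]) @
     concat (map (\<lambda>j. [(Primed j, m), (Unprimed j, m)]) [1..int n - 1])"

text \<open>The index \<open>i\<close> whose variable \<open>x\<^sub>i = q\<^bsup>i - 1\<^esup>\<close> is the weight of a primed letter in the factor
  \<open>C(q\<^bsup>2m\<^esup>)\<close>, \<open>m\<close> being its level.\<close>

definition level_index :: "primed_letter \<times> int \<Rightarrow> int" where
  "level_index e = 2 * snd e + 1 + of_bool (0 < unprime (fst e)) +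
     (if is_unprimed (fst e) then \<bar>unprime (fst e)\<bar> else 0)"

definition forget_prime :: "primed_letter \<times> int \<Rightarrow> int \<times> int" where
  "forget_prime e = (unprime (fst e), level_index e)"

lemma B_factors_staircase:
  assumes "n \<ge> 1"
  shows "factors_equiv n x (concat (map (B_factor n) [1 - 2 * int K..0]) @ staircase n 0)
     (staircase n (- 2 * int K) @ map forget_prime (concat (map (C_factor n) [- int K..- 1])))"
proof (induction K)
  case 0
  then show ?case by simp
next
  case (Suc K)
  \<comment> \<open>Level m = -K - 1 corresponds to the two indices 2m + 1 and 2m + 2, which are
    \<open>?i\<close> and \<open>?i + 1\<close>.\<close>
  let ?i = "- 2 * int K - 1"
  have C: "map forget_prime (C_factor n (- int K - 1)) = concat (map (\<lambda>j. [(- j, ?i), (- j, j + ?i)]) [1..int n - 1]) @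
      concat (map (\<lambda>j. [(j, ?i + 1), (j, j + (?i + 1))]) [1..int n - 1])"
    unfolding C_factor_def map_append map_concat map_map
    by (intro arg_cong2[of _ _ _ _ append] arg_cong[of _ _ concat] map_cong)
      (auto simp: forget_prime_def level_index_def)
  have "[1 - 2 * int (Suc K)..0] = [?i, ?i + 1] @ [1 - 2 * int K..0]"
    by (simp add: upto_rec1)
  then have "concat (map (B_factor n) [1 - 2 * int (Suc K)..0]) @ staircase n 0 =
     (B_factor n ?i @ B_factor n (?i + 1)) @ concat (map (B_factor n) [1 - 2 * int K..0]) @ staircase n 0"
    by simp
  also have "factors_equiv n x \<dots> ((B_factor n ?i @ B_factor n (?i + 1)) @ staircase n (- 2 * int K) @
      map forget_prime (concat (map (C_factor n) [- int K..- 1])))"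
    by (intro factors_equiv_append[OF factors_equiv_refl] Suc)
  also have "\<dots> = (B_factor n ?i @ B_factor n (?i + 1) @ staircase n (?i + 1)) @
      map forget_prime (concat (map (C_factor n) [- int K..- 1]))"
    by simp
  also have "factors_equiv n x \<dots> ((staircase n (?i - 1) @ map forget_prime (C_factor n (- int K - 1))) @
      map forget_prime (concat (map (C_factor n) [- int K..- 1])))"
    unfolding C by (intro factors_equiv_append[OF _ factors_equiv_refl] B_factor_staircase assms)
  also have "\<dots> = staircase n (- 2 * int (Suc K)) @ map forget_prime (concat (map (C_factor n) [- int (Suc K)..- 1]))"
  proof -
    have "[- int (Suc K)..- 1] = (- int K - 1) # [- int K..- 1]"
      by (simp add: upto_rec1)
    moreover have "?i - 1 = - 2 * int (Suc K)" by simp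
    ultimately show ?thesis by (metis append_assoc concat.simps(2) list.simps(9) map_append)
  qed
  finally show ?case .
qed

section \<open>Hecke words\<close>

definition neg_simple :: "int \<Rightarrow> int" where
  "neg_simple i = (if i = 1 then - 2 else if i = 2 then - 1 else if i = - 1 then 2 else if i = - 2 then 1 else i)"

definition pos_simple :: "int \<Rightarrow> int \<Rightarrow> int" where
  "pos_simple A i = (if i = A then A + 1 else if i = A + 1 then A
     else if i = - A then - A - 1 else if i = - A - 1 then - A else i)"

lemma refl_D_neg1: "refl_D (- 1) = neg_simple"
  by (auto simp: refl_D_def neg_simple_def transpose_def fun_eq_iff)

lemma refl_D_abs:
  assumes "a \<noteq> - 1" "a \<noteq> 0"
  shows "refl_D a = pos_simple \<bar>a\<bar>"
proof -
  have "transpose A (A + 1) (transpose (- A) (- A - 1) i) = pos_simple A i" if "0 < A" for A i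
    using that by (simp add: transpose_def pos_simple_def)
  from this[of "\<bar>a\<bar>"] show ?thesis using assms by (simp add: refl_D_def fun_eq_iff)
qed

lemma refl_D_cases [consumes 1, case_names neg pos]:
  assumes "a \<in> letters n"
  obtains "a = - 1" "refl_D a = neg_simple"
  | A where "a \<noteq> - 1" "\<bar>a\<bar> = A" "0 < A" "A + 1 \<le> int n" "refl_D a = pos_simple A"
proof (cases "a = - 1")
  case True
  then show ?thesis using that(1) refl_D_neg1 by simp
next
  case False
  have "1 \<le> \<bar>a\<bar>" "\<bar>a\<bar> < int n" using assms by (auto simp: letters_def)
  then show ?thesis using that(2)[of "\<bar>a\<bar>"] refl_D_abs[of a] False by fastforce
qed

lemma refl_D_uminus: "2 \<le> \<bar>a\<bar> \<Longrightarrow> refl_D (- a) = refl_D a"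
  by (auto simp: refl_D_def)

lemma abs_pos_simple: "0 < A \<Longrightarrow> \<bar>pos_simple A i\<bar> = transpose A (A + 1) \<bar>i\<bar>"
  unfolding transpose_def pos_simple_def by (simp add: abs_if)

lemma abs_neg_simple: "\<bar>neg_simple i\<bar> = transpose 1 2 \<bar>i\<bar>"
  unfolding transpose_def neg_simple_def by (simp add: abs_if)

text \<open>Forgetting signs is a homomorphism to permutations of absolute values; it sends the
  letters 1 and -1 alike to the transposition of 1 and 2. Distinctness of short products is mostly
  read off in this quotient.\<close>

lemma abs_refl_D: "a \<in> letters n \<Longrightarrow> \<bar>refl_D a i\<bar> = transpose \<bar>a\<bar> (\<bar>a\<bar> + 1) \<bar>i\<bar>"
  by (erule refl_D_cases) (simp_all add: abs_pos_simple abs_neg_simple)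

lemma refl_D_fixed: "a \<in> letters n \<Longrightarrow> \<bar>i\<bar> \<notin> {\<bar>a\<bar>, \<bar>a\<bar> + 1} \<Longrightarrow> refl_D a i = i"
  by (erule refl_D_cases) (auto simp: pos_simple_def neg_simple_def)

lemma refl_D_odd: "a \<in> letters n \<Longrightarrow> refl_D a (- i) = - refl_D a i"
  by (erule refl_D_cases) (auto simp: pos_simple_def neg_simple_def)

lemma refl_D_neg_iff:
  "a \<in> letters n \<Longrightarrow> i \<noteq> 0 \<Longrightarrow> refl_D a i < 0 \<longleftrightarrow> (i < 0) \<noteq> (a = - 1 \<and> \<bar>i\<bar> \<le> 2)"
  by (erule refl_D_cases) (auto simp: pos_simple_def neg_simple_def)

lemma refl_D_eq_0_iff: "a \<in> letters n \<Longrightarrow> refl_D a i = 0 \<longleftrightarrow> i = 0"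
  by (erule refl_D_cases) (auto simp: pos_simple_def neg_simple_def)

lemma refl_D_involution: "a \<in> letters n \<Longrightarrow> refl_D a \<circ> refl_D a = id"
  by (erule refl_D_cases) (auto simp: pos_simple_def neg_simple_def fun_eq_iff)

lemma refl_D_permutes: "a \<in> letters n \<Longrightarrow> refl_D a permutes {- int n..int n}"
  unfolding refl_D_def
  by (auto simp: letters_def intro!: permutes_compose permutes_swap_id)

lemma refl_D_braid_pos:
  assumes "0 < a"
  shows "refl_D a \<circ> refl_D (a + 1) \<circ> refl_D a = refl_D (a + 1) \<circ> refl_D a \<circ> refl_D (a + 1)"
proof
  fix i
  consider "i = a" | "i = a + 1" | "i = a + 2" | "i = - a" | "i = - a - 1" | "i = - a - 2"
    | "i \<notin> {a, a + 1, a + 2, - a, - a - 1, - a - 2}" by blast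
  then show "(refl_D a \<circ> refl_D (a + 1) \<circ> refl_D a) i = (refl_D (a + 1) \<circ> refl_D a \<circ> refl_D (a + 1)) i"
    by cases (use assms in \<open>simp_all add: refl_D_abs pos_simple_def\<close>)
qed

lemma refl_D_braid_neg:
  "refl_D (- 1) \<circ> refl_D 2 \<circ> refl_D (- 1) = refl_D 2 \<circ> refl_D (- 1) \<circ> refl_D 2"
proof
  fix i :: int
  consider "i \<in> {1, 2, 3, - 1, - 2, - 3}" | "i \<notin> {1, 2, 3, - 1, - 2, - 3}" by blast
  then show "(refl_D (- 1) \<circ> refl_D 2 \<circ> refl_D (- 1)) i = (refl_D 2 \<circ> refl_D (- 1) \<circ> refl_D 2) i"
    by cases (auto simp: refl_D_neg1 refl_D_abs pos_simple_def neg_simple_def)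
qed

lemma refl_D_braid:
  assumes "a \<in> letters n" "b \<in> letters n" "adj a b"
  shows "refl_D a \<circ> refl_D b \<circ> refl_D a = refl_D b \<circ> refl_D a \<circ> refl_D b"
proof -
  have *: "refl_D a \<circ> refl_D b \<circ> refl_D a = refl_D b \<circ> refl_D a \<circ> refl_D b"
    if "a \<in> letters n" "b \<in> letters n" "\<bar>b\<bar> = \<bar>a\<bar> + 1" for a b
  proof -
    have b: "refl_D b = refl_D (\<bar>a\<bar> + 1)"
      using that refl_D_uminus[of b] by (auto simp: letters_def abs_if split: if_splits)
    show ?thesis
    proof (cases "a = - 1")
      case True
      then show ?thesis using refl_D_braid_neg b by simp
    next
      case False
      moreover have pos: "0 < \<bar>a\<bar>" using that(1) by (auto simp: letters_def)
      ultimately have "refl_D a = refl_D \<bar>a\<bar>" using refl_D_abs[of a] refl_D_abs[of "\<bar>a\<bar>"] by auto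
      then show ?thesis
        using refl_D_braid_pos[of "\<bar>a\<bar>"] b pos by simp
    qed
  qed
  from assms(3) have "\<bar>b\<bar> = \<bar>a\<bar> + 1 \<or> \<bar>a\<bar> = \<bar>b\<bar> + 1" by (auto simp: adj_def)
  then show ?thesis using *[of a b] *[of b a] assms by auto
qed

lemma refl_D_commute:
  assumes "a \<in> letters n" "b \<in> letters n" "\<not> adj a b"
  shows "refl_D a \<circ> refl_D b = refl_D b \<circ> refl_D a"
proof (cases "\<bar>a\<bar> = \<bar>b\<bar>")
  case True
  then consider "a = b" | "a = - b" "2 \<le> \<bar>b\<bar>" | "a = 1" "b = - 1" | "a = - 1" "b = 1"
    using assms by (force simp: letters_def)
  then show ?thesis
    by cases (auto simp: refl_D_uminus refl_D_neg1 refl_D_abs fun_eq_iff pos_simple_def neg_simple_def)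
next
  case False
  then have far: "2 \<le> \<bar>\<bar>a\<bar> - \<bar>b\<bar>\<bar>" using assms(3) unfolding adj_def by arith
  have fixed: "refl_D d (refl_D c i) = refl_D c i" "refl_D d i = i"
    if "c \<in> letters n" "d \<in> letters n" "2 \<le> \<bar>\<bar>c\<bar> - \<bar>d\<bar>\<bar>" "\<bar>i\<bar> \<in> {\<bar>c\<bar>, \<bar>c\<bar> + 1}" for c d i
  proof -
    have "\<bar>refl_D c i\<bar> \<in> {\<bar>c\<bar>, \<bar>c\<bar> + 1}"
      using that(4) by (auto simp: abs_refl_D[OF that(1)])
    then show "refl_D d (refl_D c i) = refl_D c i" "refl_D d i = i"
      using that(3,4) by (auto intro!: refl_D_fixed[OF that(2)])
  qed
  have "refl_D a (refl_D b i) = refl_D b (refl_D a i)" for i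
  proof -
    consider "\<bar>i\<bar> \<in> {\<bar>a\<bar>, \<bar>a\<bar> + 1}" | "\<bar>i\<bar> \<in> {\<bar>b\<bar>, \<bar>b\<bar> + 1}"
      | "\<bar>i\<bar> \<notin> {\<bar>a\<bar>, \<bar>a\<bar> + 1}" "\<bar>i\<bar> \<notin> {\<bar>b\<bar>, \<bar>b\<bar> + 1}" by blast
    then show ?thesis
    proof cases
      case 1
      then show ?thesis using fixed[OF assms(1,2) far] by simp
    next
      case 2
      have "2 \<le> \<bar>\<bar>b\<bar> - \<bar>a\<bar>\<bar>" using far by arith
      then show ?thesis using fixed[OF assms(2,1) _ 2] by simp
    next
      case 3
      then show ?thesis using refl_D_fixed[OF assms(1)] refl_D_fixed[OF assms(2)] by simp
    qed
  qed
  then show ?thesis by (simp add: fun_eq_iff)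
qed

section \<open>Lengths of products of up to three reflections\<close>

lemma refl_D_ne_id: "a \<in> letters n \<Longrightarrow> refl_D a \<noteq> id"
  using abs_refl_D[of a n "\<bar>a\<bar>"] by (auto simp: letters_def)

lemma refl_D_mult_ne_id:
  assumes "a \<in> letters n" "refl_D a \<noteq> refl_D b"
  shows "refl_D a \<circ> refl_D b \<noteq> id"
proof
  assume *: "refl_D a \<circ> refl_D b = id"
  have "refl_D a = refl_D a \<circ> (refl_D a \<circ> refl_D b)" using * by simp
  also have "\<dots> = refl_D b" unfolding comp_assoc[symmetric] refl_D_involution[OF assms(1)] by simp
  finally show False using assms(2) by simp
qed

lemma abs_refl_D_mult:
  assumes "a \<in> letters n" "b \<in> letters n"
  shows "\<bar>(refl_D a \<circ> refl_D b) i\<bar> = transpose \<bar>a\<bar> (\<bar>a\<bar> + 1) (transpose \<bar>b\<bar> (\<bar>b\<bar> + 1) \<bar>i\<bar>)"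
  by (simp only: comp_apply abs_refl_D[OF assms(1)] abs_refl_D[OF assms(2)])

lemma transpose_step_cases:
  fixes C i :: int
  shows "transpose C (C + 1) i = i \<or> i = C \<and> transpose C (C + 1) i = i + 1 \<or>
    i = C + 1 \<and> transpose C (C + 1) i = i - 1"
  by (simp add: transpose_def)

text \<open>Equal factors cancel, adjacent ones move some point by two, and distant ones move both
  \<open>A\<close> and \<open>B\<close> up, whereas a simple transposition moves one point up and
  none by two. Arguments are positive because the application is to absolute values.\<close>

lemma transpose_mult_ne_transpose:
  fixes A B C :: int
  assumes T: "\<And>i. 0 < i \<Longrightarrow> transpose A (A + 1) (transpose B (B + 1) i) = transpose C (C + 1) i"
    and pos: "0 < A" "0 < B" "0 < C"
  shows False
proof -
  consider "A = B" | "B = A + 1" | "A = B + 1" | "\<bar>A - B\<bar> \<ge> 2" by arith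
  then show False
  proof cases
    case 1
    then show False using T[OF pos(3)] by simp
  next
    case 2
    have "transpose C (C + 1) (A + 2) = A"
      using T[of "A + 2"] pos(1) by (simp add: 2 transpose_def)
    then show False using transpose_step_cases[of C "A + 2"] by linarith
  next
    case 3
    have "transpose C (C + 1) B = B + 2"
      using T[of B] pos(2) by (simp add: 3 transpose_def)
    then show False using transpose_step_cases[of C B] by linarith
  next
    case 4
    then have "A \<noteq> B" "A \<noteq> B + 1" "B + 1 \<noteq> A + 1" by auto
    moreover from 4 have "B + 1 \<noteq> A" by auto
    ultimately have "transpose B (B + 1) A = A" "transpose A (A + 1) (B + 1) = B + 1"
      by (simp_all add: transpose_def)
    then have C: "transpose C (C + 1) A = A + 1" "transpose C (C + 1) B = B + 1"
      using T[OF pos(1)] T[OF pos(2)] by (simp_all only: transpose_apply_first)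
    have "C = A" using C(1) transpose_step_cases[of C A] by linarith
    moreover have "C = B" using C(2) transpose_step_cases[of C B] by linarith
    ultimately show False using \<open>A \<noteq> B\<close> by simp
  qed
qed

lemma refl_D_mult_ne_refl_D:
  assumes "a \<in> letters n" "b \<in> letters n" "c \<in> letters n"
  shows "refl_D a \<circ> refl_D b \<noteq> refl_D c"
proof
  assume *: "refl_D a \<circ> refl_D b = refl_D c"
  have "transpose \<bar>a\<bar> (\<bar>a\<bar> + 1) (transpose \<bar>b\<bar> (\<bar>b\<bar> + 1) i) = transpose \<bar>c\<bar> (\<bar>c\<bar> + 1) i" if "0 < i" for i
    using abs_refl_D_mult[OF assms(1,2), of i] abs_refl_D[OF assms(3), of i] that * by simp
  then show False by (rule transpose_mult_ne_transpose) (use assms in \<open>auto simp: letters_def\<close>)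
qed

text \<open>Without signs the braid word is the transposition of m and m + 2, with m the smaller
  absolute value. The jump by two excludes a single reflection; together with the fixed midpoint it
  excludes a product of two.\<close>

lemma abs_refl_D_braid:
  assumes "a \<in> letters n" "b \<in> letters n" "adj a b"
  obtains m where "0 < m" "\<bar>(refl_D a \<circ> refl_D b \<circ> refl_D a) m\<bar> = m + 2"
    "\<bar>(refl_D a \<circ> refl_D b \<circ> refl_D a) (m + 1)\<bar> = m + 1"
proof -
  have *: "\<bar>(refl_D a \<circ> refl_D b \<circ> refl_D a) i\<bar> = transpose \<bar>a\<bar> (\<bar>a\<bar> + 1)
      (transpose \<bar>b\<bar> (\<bar>b\<bar> + 1) (transpose \<bar>a\<bar> (\<bar>a\<bar> + 1) \<bar>i\<bar>))" for i
    by (simp add: abs_refl_D[OF assms(1)] abs_refl_D[OF assms(2)])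
  have pos: "0 < \<bar>a\<bar>" "0 < \<bar>b\<bar>" using assms by (auto simp: letters_def)
  consider "\<bar>b\<bar> = \<bar>a\<bar> + 1" | "\<bar>a\<bar> = \<bar>b\<bar> + 1"
    using assms(3) unfolding adj_def by arith
  then show ?thesis
  proof cases
    case 1
    show ?thesis by (rule that[of "\<bar>a\<bar>"]; (subst *)?) (use pos in \<open>simp_all add: 1 transpose_def\<close>)
  next
    case 2
    show ?thesis by (rule that[of "\<bar>b\<bar>"]; (subst *)?) (use pos in \<open>simp_all add: 2 transpose_def\<close>)
  qed
qed

lemma refl_D_braid_ne_refl_D:
  assumes "a \<in> letters n" "b \<in> letters n" "adj a b" "c \<in> letters n"
  shows "refl_D a \<circ> refl_D b \<circ> refl_D a \<noteq> refl_D c"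
proof
  assume *: "refl_D a \<circ> refl_D b \<circ> refl_D a = refl_D c"
  from abs_refl_D_braid[OF assms(1-3)] obtain m where "0 < m" "\<bar>refl_D c m\<bar> = m + 2"
    unfolding * by metis
  then show False using abs_refl_D[OF assms(4), of m] transpose_step_cases[of "\<bar>c\<bar>" m] by simp
qed

lemma refl_D_braid_ne_mult:
  assumes "a \<in> letters n" "b \<in> letters n" "adj a b" "c \<in> letters n" "d \<in> letters n"
  shows "refl_D a \<circ> refl_D b \<circ> refl_D a \<noteq> refl_D c \<circ> refl_D d"
proof
  assume *: "refl_D a \<circ> refl_D b \<circ> refl_D a = refl_D c \<circ> refl_D d"
  define C D where "C = \<bar>c\<bar>" and "D = \<bar>d\<bar>"
  from abs_refl_D_braid[OF assms(1-3)] obtain m where m: "0 < m"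
      "\<bar>(refl_D c \<circ> refl_D d) m\<bar> = m + 2" "\<bar>(refl_D c \<circ> refl_D d) (m + 1)\<bar> = m + 1"
    unfolding * by metis
  then have T: "transpose C (C + 1) (transpose D (D + 1) m) = m + 2"
      "transpose C (C + 1) (transpose D (D + 1) (m + 1)) = m + 1"
    unfolding abs_refl_D_mult[OF assms(4,5)] by (simp_all add: C_def D_def)
  define j where "j = transpose D (D + 1) m"
  have j: "j \<le> m + 1" "j = m + 1 \<Longrightarrow> D = m"
    using transpose_step_cases[of D m] unfolding j_def by linarith+
  have "transpose C (C + 1) j = m + 2" using T(1) by (simp add: j_def)
  \<comment> \<open>The jump by two determines both transpositions, and their product sends m + 1 to
    m instead of fixing it.\<close>
  then have "j = m + 1" "C = m + 1" using j(1) transpose_step_cases[of C j] by linarith+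
  then show False using T(2) j(2) by (simp add: transpose_def)
qed

lemma len_D_eqI:
  assumes "set a \<subseteq> letters n" "word_perm a = w"
    and "\<And>b. set b \<subseteq> letters n \<Longrightarrow> length b < length a \<Longrightarrow> word_perm b \<noteq> w"
  shows "len_D n w = length a"
  unfolding len_D_def
proof (rule Least_equality)
  show "\<exists>b. set b \<subseteq> letters n \<and> length b = length a \<and> word_perm b = w" using assms by blast
  show "length a \<le> k" if "\<exists>b. set b \<subseteq> letters n \<and> length b = k \<and> word_perm b = w" for k
    using that assms(3) not_le_imp_less by blast
qed

lemma word_perm_simps: "word_perm [] = id" "word_perm (a # as) = refl_D a \<circ> word_perm as"
  by (simp_all add: word_perm_def)

lemma len_D_refl_D: "a \<in> letters n \<Longrightarrow> len_D n (refl_D a) = 1"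
  using len_D_eqI[of "[a]" n "refl_D a"] refl_D_ne_id[of a n] by (force simp: word_perm_simps)

lemma len_D_mult:
  assumes "a \<in> letters n" "b \<in> letters n" "refl_D a \<noteq> refl_D b"
  shows "len_D n (refl_D a \<circ> refl_D b) = 2"
proof -
  have "word_perm c \<noteq> refl_D a \<circ> refl_D b" if c: "set c \<subseteq> letters n" "length c < 2" for c
  proof -
    from c(2) consider "c = []" | d where "c = [d]"
      \<comment> \<open>\<open>remdups_adj.cases\<close> serves only for its split into lists with
        zero, one, or at least two entries.\<close>
      by (cases c rule: remdups_adj.cases) auto
    then show ?thesis
      using refl_D_mult_ne_id[of a n b] refl_D_mult_ne_refl_D[of a n b] assms c(1)
      by cases (simp_all add: word_perm_simps, metis)
  qed
  then show ?thesis using len_D_eqI[of "[a, b]" n] assms by (simp add: word_perm_simps)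
qed

lemma len_D_braid:
  assumes "a \<in> letters n" "b \<in> letters n" "adj a b"
  shows "len_D n (refl_D a \<circ> refl_D b \<circ> refl_D a) = 3"
proof -
  have "word_perm c \<noteq> refl_D a \<circ> refl_D b \<circ> refl_D a" if c: "set c \<subseteq> letters n" "length c < 3" for c
  proof -
    from c(2) consider "c = []" | d where "c = [d]" | d e where "c = [d, e]"
      by (cases c rule: remdups_adj.cases) (auto simp: less_Suc_eq numeral_3_eq_3)
    then show ?thesis
    proof cases
      case 1
      have "refl_D a \<circ> refl_D b \<circ> refl_D a \<noteq> id"
      proof
        assume *: "refl_D a \<circ> refl_D b \<circ> refl_D a = id"
        have "refl_D b = (refl_D a \<circ> refl_D a) \<circ> refl_D b \<circ> (refl_D a \<circ> refl_D a)"
          using refl_D_involution[OF assms(1)] by simp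
        also have "\<dots> = refl_D a \<circ> (refl_D a \<circ> refl_D b \<circ> refl_D a) \<circ> refl_D a"
          by (simp add: comp_assoc)
        also have "\<dots> = id" using * refl_D_involution[OF assms(1)] by simp
        finally show False using refl_D_ne_id assms(2) by metis
      qed
      then show ?thesis using 1 by (simp add: word_perm_simps)
    next
      case (2 d)
      then show ?thesis using refl_D_braid_ne_refl_D[of a n b d] assms c(1)
        by (simp add: word_perm_simps)
    next
      case (3 d e)
      then show ?thesis using refl_D_braid_ne_mult[of a n b d e] assms c(1)
        by (simp add: word_perm_simps)
    qed
  qed
  then show ?thesis using len_D_eqI[of "[a, b, a]" n] assms by (simp add: word_perm_simps comp_assoc)
qed

lemma refl_D_in_WD:
  assumes "a \<in> letters n"
  shows "refl_D a \<in> WD n"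
proof -
  have "{i. 0 < i \<and> refl_D a i < 0} = (if a = - 1 then {1, 2} else {})"
    using refl_D_neg_iff[OF assms] by auto
  then show ?thesis
    using refl_D_permutes[OF assms] refl_D_odd[OF assms] by (simp add: WD_def)
qed

lemma refl_D_mult_in_WD:
  assumes "a \<in> letters n" "b \<in> letters n" "adj a b"
  shows "refl_D a \<circ> refl_D b \<in> WD n"
proof -
  have *: "0 < i \<and> refl_D a (refl_D b i) < 0 \<longleftrightarrow>
     0 < i \<and> ((b = - 1 \<and> i \<le> 2) \<noteq> (a = - 1 \<and> transpose \<bar>b\<bar> (\<bar>b\<bar> + 1) i \<le> 2))" for i
    using refl_D_neg_iff[OF assms(1), of "refl_D b i"] refl_D_neg_iff[OF assms(2), of i]
      refl_D_eq_0_iff[OF assms(2), of i] abs_refl_D[OF assms(2), of i] by auto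
  have "even (card {i. 0 < i \<and> refl_D a (refl_D b i) < 0})"
  proof (cases "a = - 1")
    case True
    then have "\<bar>b\<bar> = 2" using assms by (auto simp: adj_def letters_def)
    then have "{i. 0 < i \<and> refl_D a (refl_D b i) < 0} = {1, 3}"
      unfolding * using True by (auto simp: transpose_def)
    then show ?thesis by simp
  next
    case False
    then have "{i. 0 < i \<and> refl_D a (refl_D b i) < 0} = (if b = - 1 then {1, 2} else {})"
      unfolding * by auto
    then show ?thesis by simp
  qed
  then show ?thesis
    using permutes_compose[OF refl_D_permutes[OF assms(2)] refl_D_permutes[OF assms(1)]]
      refl_D_odd[OF assms(1)] refl_D_odd[OF assms(2)] by (simp add: WD_def)
qed

section \<open>From the algebra to invariance of Hecke words\<close>

context id_coxeter_algebra_D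
begin

abbreviation \<beta> :: "int poly" where "\<beta> \<equiv> [:0, 1:]"

definition word_prod :: "int list \<Rightarrow> 'h" where
  "word_prod a = prod_list (map (\<lambda>b. \<pi> (refl_D b)) a)"

lemma generator_mult:
  assumes "a \<in> letters n" "b \<in> letters n" "refl_D a \<noteq> refl_D b"
  shows "\<pi> (refl_D a) * \<pi> (refl_D b) = \<pi> (refl_D a \<circ> refl_D b)"
  by (rule mult_reduced) (use assms len_D_mult len_D_refl_D refl_D_in_WD in auto)

lemma generator_commute:
  assumes "a \<in> letters n" "b \<in> letters n" "\<not> adj a b"
  shows "\<pi> (refl_D a) * \<pi> (refl_D b) = \<pi> (refl_D b) * \<pi> (refl_D a)"
proof (cases "refl_D a = refl_D b")
  case False
  then show ?thesis using generator_mult assms refl_D_commute by metis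
qed simp

lemma generator_braid:
  assumes "a \<in> letters n" "b \<in> letters n" "adj a b"
  shows "\<pi> (refl_D a) * \<pi> (refl_D b) * \<pi> (refl_D a) = \<pi> (refl_D b) * \<pi> (refl_D a) * \<pi> (refl_D b)"
proof -
  have *: "\<pi> (refl_D a) * \<pi> (refl_D b) * \<pi> (refl_D a) = \<pi> (refl_D a \<circ> refl_D b \<circ> refl_D a)"
    if ab: "a \<in> letters n" "b \<in> letters n" "adj a b" for a b
  proof -
    have ne: "refl_D b \<noteq> refl_D a"
    proof
      assume "refl_D b = refl_D a"
      then have "transpose \<bar>a\<bar> (\<bar>a\<bar> + 1) \<bar>i\<bar> = transpose \<bar>b\<bar> (\<bar>b\<bar> + 1) \<bar>i\<bar>" for i
        using abs_refl_D ab by metis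
      from this[of a] show False using ab by (auto simp: adj_def transpose_def split: if_splits)
    qed
    have "\<pi> (refl_D a) * \<pi> (refl_D b) * \<pi> (refl_D a) = \<pi> (refl_D a) * \<pi> (refl_D b \<circ> refl_D a)"
      using generator_mult[OF ab(2,1) ne] by (simp add: mult.assoc)
    also have "\<dots> = \<pi> (refl_D a \<circ> (refl_D b \<circ> refl_D a))"
    proof (rule mult_reduced)
      have "adj b a" using ab(3) by (auto simp: adj_def)
      then show "refl_D b \<circ> refl_D a \<in> WD n" using refl_D_mult_in_WD ab by blast
      show "len_D n (refl_D a \<circ> (refl_D b \<circ> refl_D a)) = len_D n (refl_D a) + len_D n (refl_D b \<circ> refl_D a)"
        using len_D_braid[OF ab] len_D_mult[OF ab(2,1) ne] len_D_refl_D[OF ab(1)] by (simp add: comp_assoc)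
    qed (use refl_D_in_WD ab in auto)
    finally show ?thesis by (simp add: comp_assoc)
  qed
  have "adj b a" using assms(3) by (auto simp: adj_def)
  then show ?thesis using *[OF assms] *[OF assms(2,1)] refl_D_braid[OF assms] by simp
qed

text \<open>\<open>\<beta>\<close> is neither a zero divisor nor a unit among the coefficients, so
  comparing coordinates in the basis divides the equation by it and also shows that the exponent was
  positive.\<close>

lemma scale_beta_cancel:
  assumes "w \<in> WD n" "scale \<beta> y = scale (\<beta> ^ k) (\<pi> w)"
  obtains j where "k = Suc j" "y = scale (\<beta> ^ j) (\<pi> w)"
proof -
  have "y \<in> span (\<pi> ` WD n)" using basis_span by simp
  then obtain t r where t: "finite t" "t \<subseteq> \<pi> ` WD n" "y = (\<Sum>b\<in>t. scale (r b) b)"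
    unfolding span_explicit by blast
  define T where "T = insert (\<pi> w) t"
  define R where "R b = (if b \<in> t then r b else 0)" for b
  have T: "finite T" "T \<subseteq> \<pi> ` WD n" "\<pi> w \<in> T" using t assms(1) by (auto simp: T_def)
  have y: "y = (\<Sum>b\<in>T. scale (R b) b)"
    unfolding t(3) by (rule sum.mono_neutral_cong_left) (use t(1) in \<open>auto simp: T_def R_def\<close>)
  have "(\<Sum>b\<in>T. scale (\<beta> * R b - (if b = \<pi> w then \<beta> ^ k else 0)) b) =
      scale \<beta> y - (\<Sum>b\<in>T. scale (if b = \<pi> w then \<beta> ^ k else 0) b)"
    unfolding y by (simp add: scale_left_diff_distrib sum_subtractf scale_sum_right)
  also have "(\<Sum>b\<in>T. scale (if b = \<pi> w then \<beta> ^ k else 0) b) = (\<Sum>b\<in>T. if b = \<pi> w then scale (\<beta> ^ k) b else 0)"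
    by (rule sum.cong) auto
  also have "\<dots> = scale (\<beta> ^ k) (\<pi> w)" using T by simp
  finally have "(\<Sum>b\<in>T. scale (\<beta> * R b - (if b = \<pi> w then \<beta> ^ k else 0)) b) = 0" using assms(2) by simp
  from independentD[OF basis_independent T(1,2) this]
  have R: "\<beta> * R b = (if b = \<pi> w then \<beta> ^ k else 0)" if "b \<in> T" for b using that by auto
  have "\<beta> * R (\<pi> w) = \<beta> ^ k" using R T(3) by simp
  \<comment> \<open>For \<open>k = 0\<close> the equation would make \<open>\<beta>\<close>
    invertible.\<close>
  then obtain j where j: "k = Suc j"
    by (cases k) (auto simp: pCons_one[symmetric])
  have "R b = (if b = \<pi> w then \<beta> ^ j else 0)" if "b \<in> T" for b
    using R[OF that] unfolding j by (auto split: if_splits)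
  then have "y = (\<Sum>b\<in>T. if b = \<pi> w then scale (\<beta> ^ j) b else 0)"
    unfolding y by (intro sum.cong) auto
  also have "\<dots> = scale (\<beta> ^ j) (\<pi> w)" using T by simp
  finally show ?thesis using that j by blast
qed

lemma mem_Hecke_D_iff:
  "a \<in> Hecke_D n scale \<pi> w \<longleftrightarrow> set a \<subseteq> letters n \<and> len_D n w \<le> length a \<and>
     word_prod a = scale (\<beta> ^ (length a - len_D n w)) (\<pi> w)"
  by (simp add: Hecke_D_def word_prod_def)

lemma word_prod_simps:
  "word_prod (a @ b) = word_prod a * word_prod b" "word_prod (c # b) = \<pi> (refl_D c) * word_prod b"
  by (simp_all add: word_prod_def)

text \<open>Doubling a letter multiplies the product by exactly \<open>\<beta>\<close>, in step with
  the exponent. The converse divides by it; the positive exponent from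
  \<open>scale_beta_cancel\<close> keeps the shorter word at least \<open>len_D n w\<close>
  long.\<close>

lemma Hecke_D_idempotent:
  assumes "w \<in> WD n" "a \<in> letters n"
  shows "u @ [a, a] @ v \<in> Hecke_D n scale \<pi> w \<longleftrightarrow> u @ [a] @ v \<in> Hecke_D n scale \<pi> w"
proof -
  let ?l = "length u + length v"
  have eq: "word_prod (u @ [a, a] @ v) = scale \<beta> (word_prod (u @ [a] @ v))"
    unfolding word_prod_simps append_Cons append_Nil mult.assoc[symmetric]
    by (simp add: mult.assoc[of _ "\<pi> (refl_D a)" "\<pi> (refl_D a)"] mult_simple[OF assms(2)]
        scale_mult_left scale_mult_right)
  show ?thesis
  proof
    assume *: "u @ [a] @ v \<in> Hecke_D n scale \<pi> w"
    then show "u @ [a, a] @ v \<in> Hecke_D n scale \<pi> w"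
      unfolding mem_Hecke_D_iff eq by (auto simp: Suc_diff_le)
  next
    assume *: "u @ [a, a] @ v \<in> Hecke_D n scale \<pi> w"
    then have le: "len_D n w \<le> ?l + 2"
      and "scale \<beta> (word_prod (u @ [a] @ v)) = scale (\<beta> ^ (?l + 2 - len_D n w)) (\<pi> w)"
      unfolding mem_Hecke_D_iff eq by auto
    from scale_beta_cancel[OF assms(1) this(2)] obtain j where
      j: "?l + 2 - len_D n w = Suc j" "word_prod (u @ [a] @ v) = scale (\<beta> ^ j) (\<pi> w)" by blast
    then have "j = length (u @ [a] @ v) - len_D n w" "len_D n w \<le> length (u @ [a] @ v)" by auto
    then show "u @ [a] @ v \<in> Hecke_D n scale \<pi> w"
      using * j(2) unfolding mem_Hecke_D_iff by auto
  qed
qed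

text \<open>The axioms of the algebra enter the main argument only through this invariance.\<close>

lemma Hecke_invariant_Hecke_D:
  assumes "w \<in> WD n"
  shows "Hecke_invariant n (\<lambda>a. if a \<in> Hecke_D n scale \<pi> w then c else d)"
proof -
  have cong: "u @ a @ v \<in> Hecke_D n scale \<pi> w \<longleftrightarrow> u @ b @ v \<in> Hecke_D n scale \<pi> w"
    if "set a \<subseteq> letters n" "set b \<subseteq> letters n" "length a = length b" "word_prod a = word_prod b" for u v a b
    using that by (simp add: mem_Hecke_D_iff word_prod_simps)
  show ?thesis
    unfolding Hecke_invariant_def
  proof (intro allI ballI conjI impI if_cong refl)
    fix u v a b assume a: "a \<in> letters n" and b: "b \<in> letters n"
    show "u @ [a, a] @ v \<in> Hecke_D n scale \<pi> w \<longleftrightarrow> u @ [a] @ v \<in> Hecke_D n scale \<pi> w"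
      by (rule Hecke_D_idempotent[OF assms a])
    show "u @ [- a] @ v \<in> Hecke_D n scale \<pi> w \<longleftrightarrow> u @ [a] @ v \<in> Hecke_D n scale \<pi> w" if "2 \<le> \<bar>a\<bar>"
      using a that by (intro cong) (auto simp: word_prod_def refl_D_uminus letters_def)
    show "u @ [a, b] @ v \<in> Hecke_D n scale \<pi> w \<longleftrightarrow> u @ [b, a] @ v \<in> Hecke_D n scale \<pi> w" if "\<not> adj a b"
      using a b generator_commute[OF a b that] by (intro cong) (auto simp: word_prod_def)
    show "u @ [a, b, a] @ v \<in> Hecke_D n scale \<pi> w \<longleftrightarrow> u @ [b, a, b] @ v \<in> Hecke_D n scale \<pi> w" if "adj a b"
      using a b generator_braid[OF a b that] by (intro cong) (auto simp: word_prod_def mult.assoc)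
  qed
qed

end

section \<open>Expansion of the factorizations\<close>

text \<open>For a strict order the sorted lists over \<open>set zs\<close> are the subsequences of
  \<open>zs\<close>, split by whether the head is taken. This matches the recursion of
  \<open>factors\<close>.\<close>

lemma sorted_sublists_Cons:
  assumes "transp P" "irreflp P" "sorted_wrt P (z # zs)"
  shows "{ys. sorted_wrt P ys \<and> set ys \<subseteq> set (z # zs)} =
    {ys. sorted_wrt P ys \<and> set ys \<subseteq> set zs} \<union> (#) z ` {ys. sorted_wrt P ys \<and> set ys \<subseteq> set zs}"
    (is "?L = ?S \<union> ?Z")
proof
  have "P z y" if "y \<in> set zs" for y using assms(3) that by simp
  then show "?S \<union> ?Z \<subseteq> ?L" by (auto 0 3)
  show "?L \<subseteq> ?S \<union> ?Z"
  proof
    fix ys assume ys: "ys \<in> ?L"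
    show "ys \<in> ?S \<union> ?Z"
    proof (cases ys)
      case (Cons y ys')
      have no_z: "z \<notin> set ys'"
      proof
        assume "z \<in> set ys'"
        then have "P y z" using ys Cons by simp
        moreover have "y = z \<or> P z y" using ys Cons assms(3) by auto
        ultimately show False using assms(1,2) by (metis irreflpD transpD)
      qed
      then show ?thesis using ys Cons by (cases "y = z") auto
    qed (use ys in auto)
  qed
qed

lemma finite_sorted_sublists:
  assumes "transp P" "irreflp P" "sorted_wrt P zs"
  shows "finite {ys. sorted_wrt P ys \<and> set ys \<subseteq> set zs}"
  using assms(3)
proof (induction zs)
  case Nil
  have "{ys. sorted_wrt P ys \<and> set ys \<subseteq> set []} = {[]}" by auto
  then show ?case by simp
next
  case (Cons z zs)
  then show ?case unfolding sorted_sublists_Cons[OF assms(1,2) Cons.prems] by simp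
qed

lemma factors_expand:
  assumes "transp P" "irreflp P" "sorted_wrt P zs"
  shows "factors x (map h zs) f u = (\<Sum>ys | sorted_wrt P ys \<and> set ys \<subseteq> set zs.
     (\<Prod>e\<leftarrow>ys. x (snd (h e))) * f (u @ map (\<lambda>e. fst (h e)) ys))"
  using assms(3)
proof (induction zs arbitrary: u)
  case Nil
  have "{ys. sorted_wrt P ys \<and> set ys \<subseteq> set []} = {[]}" by auto
  then show ?case by simp
next
  case (Cons z zs)
  let ?S = "{ys. sorted_wrt P ys \<and> set ys \<subseteq> set zs}"
  let ?t = "\<lambda>u ys. (\<Prod>e\<leftarrow>ys. x (snd (h e))) * f (u @ map (\<lambda>e. fst (h e)) ys)"
  have "z \<notin> set zs" using Cons.prems assms(2) by (auto dest: irreflpD)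
  then have disj: "?S \<inter> (#) z ` ?S = {}" by auto
  have fin: "finite ?S" using finite_sorted_sublists[OF assms(1,2)] Cons.prems by simp
  have "(\<Sum>ys | sorted_wrt P ys \<and> set ys \<subseteq> set (z # zs). ?t u ys) = sum (?t u) ?S + sum (?t u) ((#) z ` ?S)"
    unfolding sorted_sublists_Cons[OF assms(1,2) Cons.prems]
    using fin disj by (simp add: sum.union_disjoint)
  also have "sum (?t u) ((#) z ` ?S) = (\<Sum>ys\<in>?S. x (snd (h z)) * ?t (u @ [fst (h z)]) ys)"
    by (subst sum.reindex) (auto simp: inj_on_def mult.assoc)
  finally show ?case using Cons by (simp add: sum_distrib_left)
qed

text \<open>Stands for beta times x_i: the power of beta then counts letters and exceeds the
  exponent in the theorem by \<open>len_D n w\<close>.\<close>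

definition q_weight :: "int \<Rightarrow> qseries" where
  "q_weight i = fps_X * fps_const (q powi (i - 1))"

lemma q_powi_mult_nth: "(q powi m * f) $$ e = f $$ (e + m)"
proof -
  have "q powi m = fls_X_intpow (- m)" by (intro fls_eqI) (auto simp: q_powi_nth)
  then have "q powi m * f = fls_shift m f"
    using fls_X_intpow_times_conv_shift(1)[of "- m" f] by simp
  then show ?thesis by simp
qed

lemma q_power_mult_nth: "(q ^ k * f) $$ e = f $$ (e + int k)"
  using q_powi_mult_nth[of "int k"] by simp

lemma q_powi_add: "q powi (i + j) = q powi i * q powi j"
  by (rule power_int_add) (simp add: q_def)

lemma prod_q_weight:
  "(\<Prod>e\<leftarrow>ys. q_weight (g e)) = fps_X ^ length ys * fps_const (q powi (\<Sum>e\<leftarrow>ys. g e - 1))"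
  by (induction ys) (simp_all add: q_weight_def q_powi_add fps_const_mult[symmetric] ac_simps del: fps_const_mult)

text \<open>Each subsequence contributes one monomial with coefficient 1 or 0, so a coefficient is a
  count. Exponents in \<open>fls\<close> belong to q^{-1}, hence the sign in front of
  \<open>e\<close>.\<close>

lemma factors_q_weight_nth:
  assumes "transp P" "irreflp P" "sorted_wrt P zs"
  shows "fps_nth (factors q_weight (map h zs) (\<lambda>a. if a \<in> A then 1 else 0) []) p $$ e =
     of_nat (card {ys. sorted_wrt P ys \<and> set ys \<subseteq> set zs \<and> map (\<lambda>e. fst (h e)) ys \<in> A \<and>
       length ys = p \<and> (\<Sum>e\<leftarrow>ys. snd (h e) - 1) = - e})"
proof -
  let ?S = "{ys. sorted_wrt P ys \<and> set ys \<subseteq> set zs}"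
  let ?Q = "\<lambda>ys. map (\<lambda>e. fst (h e)) ys \<in> A \<and> length ys = p \<and> (\<Sum>e\<leftarrow>ys. snd (h e) - 1) = - e"
  have fin: "finite ?S" by (rule finite_sorted_sublists[OF assms])
  have "fps_nth (factors q_weight (map h zs) (\<lambda>a. if a \<in> A then 1 else 0) []) p $$ e =
     (\<Sum>ys\<in>?S. if ?Q ys then 1 else 0)"
    unfolding factors_expand[OF assms] fps_sum_nth fls_nth_sum prod_q_weight
    by (rule sum.cong) (auto simp: fps_X_power_mult_nth q_powi_nth)
  also have "\<dots> = of_nat (card {ys \<in> ?S. ?Q ys})"
    using fin by (simp add: sum.If_cases Collect_conj_eq Int_assoc)
  finally show ?thesis by (simp add: conj_assoc)
qed

section \<open>Degree bounds in q\<close>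

lemma q_weight_mult_nth:
  "fps_nth (q_weight i * f) p $$ e = (if p = 0 then 0 else fps_nth f (p - 1) $$ (e + (i - 1)))"
  by (simp add: q_weight_def mult.assoc q_powi_mult_nth)

text \<open>The coefficient of beta^p has degree at most M p in q.\<close>

definition degree_bounded :: "int \<Rightarrow> (int list \<Rightarrow> qseries) \<Rightarrow> bool" where
  "degree_bounded M f \<longleftrightarrow> (\<forall>u p e. e < - (M * int p) \<longrightarrow> fps_nth (f u) p $$ e = 0)"

lemma degree_bounded_factors:
  assumes "degree_bounded M f" "\<And>e. e \<in> set es \<Longrightarrow> snd e - 1 \<le> M"
  shows "degree_bounded M (factors q_weight es f)"
  using assms(2)
proof (induction es)
  case Nil
  have "factors q_weight [] f = f" by auto
  then show ?case using assms(1) by simp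
next
  case (Cons e es)
  have IH: "degree_bounded M (factors q_weight es f)" and e: "snd e - 1 \<le> M" using Cons by auto
  show ?case
    unfolding degree_bounded_def
  proof (intro allI impI)
    fix u p d assume d: "d < - (M * int p)"
    have "d + (snd e - 1) < - (M * int (p - 1))" if "p \<noteq> 0"
      using that d e by (cases p) (auto simp: algebra_simps)
    then show "fps_nth (factors q_weight (e # es) f u) p $$ d = 0"
      using IH d unfolding degree_bounded_def by (simp add: q_weight_mult_nth)
  qed
qed

text \<open>In a term using one of these factors the remaining letters have degree at most
  \<open>M\<close> each, so its degree in q stays below \<open>-d\<close>.\<close>

lemma factors_truncate:
  assumes "degree_bounded M f" "0 \<le> M"
    and "\<And>e. e \<in> set es \<Longrightarrow> snd e - 1 \<le> M \<and> d + (snd e - 1) + M * int p < 0"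
  shows "fps_nth (factors q_weight es f u) p $$ d = fps_nth (f u) p $$ d"
  using assms(3)
proof (induction es)
  case (Cons e es)
  have "degree_bounded M (factors q_weight es f)"
    by (rule degree_bounded_factors[OF assms(1)]) (use Cons.prems in auto)
  moreover have "d + (snd e - 1) < - (M * int (p - 1))" if "p \<noteq> 0"
    using that Cons.prems[of e] assms(2) by (cases p) (auto simp: algebra_simps)
  ultimately show ?case
    using Cons unfolding degree_bounded_def by (simp add: q_weight_mult_nth)
qed simp

lemma sorted_wrt_concat_map:
  assumes "sorted_wrt R xs" "\<And>x. x \<in> set xs \<Longrightarrow> sorted_wrt P (F x)"
    and "\<And>x y d e. x \<in> set xs \<Longrightarrow> y \<in> set xs \<Longrightarrow> R x y \<Longrightarrow> d \<in> set (F x) \<Longrightarrow> e \<in> set (F y) \<Longrightarrow> P d e"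
  shows "sorted_wrt P (concat (map F xs))"
  using assms
proof (induction xs)
  case (Cons a xs)
  have "sorted_wrt P (concat (map F xs))"
  proof (rule Cons.IH)
    show "P d e" if "x \<in> set xs" "y \<in> set xs" "R x y" "d \<in> set (F x)" "e \<in> set (F y)" for x y d e
      by (rule Cons.prems(3)[of x y]) (use that in simp_all)
  qed (use Cons.prems(1,2) in simp_all)
  moreover have "P d e" if "x \<in> set xs" "d \<in> set (F a)" "e \<in> set (F x)" for x d e
    using Cons.prems(1) that by (intro Cons.prems(3)[of a x]) auto
  ultimately show ?case using Cons.prems(2) by (auto simp: sorted_wrt_append)
qed simp

section \<open>The two strict orders and the finite windows\<close>

definition level_desc :: "int \<times> int \<Rightarrow> int \<times> int \<Rightarrow> bool" where
  "level_desc d e \<longleftrightarrow> snd d < snd e \<or> snd d = snd e \<and> fst e < fst d"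

definition level_asc :: "primed_letter \<times> int \<Rightarrow> primed_letter \<times> int \<Rightarrow> bool" where
  "level_asc d e \<longleftrightarrow> snd d < snd e \<or> snd d = snd e \<and> fst d \<prec> fst e"

lemma level_desc: "transp level_desc" "irreflp level_desc"
  by (auto simp: level_desc_def intro!: transpI irreflpI)

lemma transp_prec: "transp (\<prec>)"
proof (rule transpI)
  fix x y z :: primed_letter assume "x \<prec> y" "y \<prec> z"
  then show "x \<prec> z"
    unfolding prec_def
    by (cases "unprime x < 0"; cases "unprime y < 0"; cases "unprime z < 0") auto
qed

lemma irreflp_prec: "irreflp (\<prec>)"
  by (rule irreflpI) (auto simp: prec_def)

lemma level_asc: "transp level_asc" "irreflp level_asc"
proof -
  show "transp level_asc"
  proof (rule transpI)
    fix x y z assume xy: "level_asc x y" and yz: "level_asc y z"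
    show "level_asc x z"
    proof (cases "snd x = snd y \<and> snd y = snd z")
      case True
      then have "fst x \<prec> fst z"
        using xy yz transpD[OF transp_prec, of "fst x" "fst y" "fst z"] by (simp add: level_asc_def)
      then show ?thesis using True by (simp add: level_asc_def)
    next
      case False
      then show ?thesis using xy yz by (auto simp: level_asc_def)
    qed
  qed
  show "irreflp level_asc"
    using irreflpD[OF irreflp_prec] by (auto simp: level_asc_def intro!: irreflpI)
qed

lemma sorted_wrt_up:
  assumes "\<And>j k. j < k \<Longrightarrow> g k < g j"
  shows "sorted_wrt level_desc (up g N k i)"
  unfolding up_def sorted_wrt_map
  by (rule sorted_wrt_mono_rel[OF _ sorted_wrt_upto]) (auto simp: level_desc_def assms)

lemma sorted_wrt_down: "sorted_wrt level_desc (down id N k i)"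
  unfolding down_def up_def sorted_wrt_rev sorted_wrt_map
  by (rule sorted_wrt_mono_rel[OF _ sorted_wrt_upto]) (auto simp: level_desc_def)

lemma set_B_factor: "set (B_factor n i) = letters n \<times> {i}"
proof -
  have "set (B_factor n i) = ({1..int n - 1} \<union> uminus ` {1..int n - 1}) \<times> {i}"
    by (auto simp: B_factor_def set_down set_up simp del: image_uminus_atLeastAtMost)
  also have "{1..int n - 1} \<union> uminus ` {1..int n - 1} = letters n"
    by (auto simp: letters_def)
  finally show ?thesis .
qed

lemma set_staircase:
  "set (staircase n s) = {(a, i). s < i \<and> i \<le> a + s \<and> a < int n}"
proof -
  have "set (staircase n s) = (\<Union>j\<in>{1..int n - 1}. (\<lambda>t. (t, j + s)) ` {j..int n - 1})"
    by (simp add: staircase_def set_down)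
  also have "\<dots> = {(a, i). s < i \<and> i \<le> a + s \<and> a < int n}"
  proof (intro equalityI subsetI)
    fix e assume "e \<in> {(a, i). s < i \<and> i \<le> a + s \<and> a < int n}"
    then show "e \<in> (\<Union>j\<in>{1..int n - 1}. (\<lambda>t. (t, j + s)) ` {j..int n - 1})"
      by (auto intro!: bexI[of _ "snd e - s"])
  qed auto
  finally show ?thesis .
qed

text \<open>The finite part of the infinite left product with indices above -2K. Its 2K factors
  \<open>B_factor\<close> correspond to the K factors of \<open>C_window\<close>.\<close>

definition B_window :: "nat \<Rightarrow> nat \<Rightarrow> (int \<times> int) list" where
  "B_window n K = concat (map (B_factor n) [1 - 2 * int K..0]) @ staircase n 0"

definition C_window :: "nat \<Rightarrow> nat \<Rightarrow> (primed_letter \<times> int) list" where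
  "C_window n K = concat (map (C_factor n) [- int K..- 1])"

lemma sorted_B_window: "sorted_wrt level_desc (B_window n K)"
  unfolding B_window_def sorted_wrt_append
proof (intro conjI ballI)
  show "sorted_wrt level_desc (concat (map (B_factor n) [1 - 2 * int K..0]))"
  proof (rule sorted_wrt_concat_map[OF sorted_wrt_upto])
    show "sorted_wrt level_desc (B_factor n i)" for i
      by (auto simp: B_factor_def sorted_wrt_append sorted_wrt_up sorted_wrt_down set_up set_down level_desc_def)
  qed (auto simp: set_B_factor level_desc_def)
  show "sorted_wrt level_desc (staircase n 0)"
    unfolding staircase_def
    by (rule sorted_wrt_concat_map[OF sorted_wrt_upto])
      (auto simp: sorted_wrt_down set_down level_desc_def)
qed (auto simp: set_B_factor set_staircase level_desc_def)

lemma set_B_window: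
  "set (B_window n K) = {(a, i). a \<in> letters n \<and> 1 - 2 * int K \<le> i \<and> (0 < i \<longrightarrow> i \<le> a)}"
  by (auto simp: B_window_def set_B_factor set_staircase letters_def)

lemma set_C_factor: "set (C_factor n m) = {l. unprime l \<in> letters n} \<times> {m}"
proof -
  have "(l, m) \<in> set (C_factor n m)" if l: "unprime l \<in> letters n" for l
  proof -
    define j where "j = \<bar>unprime l\<bar>"
    have j: "j \<in> {1..int n - 1}" using l by (auto simp: j_def letters_def)
    have "(l, m) \<in> {(Primed (- j), m), (Unprimed (- j), m), (Primed j, m), (Unprimed j, m)}"
      by (cases l) (auto simp: j_def)
    then show ?thesis using j by (auto simp: C_factor_def)
  qed
  moreover have "set (C_factor n m) \<subseteq> {l. unprime l \<in> letters n} \<times> {m}"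
    by (auto simp: C_factor_def letters_def)
  ultimately show ?thesis by auto
qed

lemma sorted_C_window: "sorted_wrt level_asc (C_window n K)"
  unfolding C_window_def
proof (rule sorted_wrt_concat_map[OF sorted_wrt_upto])
  show "sorted_wrt level_asc (C_factor n m)" for m
    unfolding C_factor_def sorted_wrt_append
    by (intro conjI sorted_wrt_concat_map[OF sorted_wrt_upto]) (auto simp: level_asc_def prec_def)
qed (auto simp: set_C_factor level_asc_def)

lemma set_C_window: "set (C_window n K) = {(l, m). unprime l \<in> letters n \<and> - int K \<le> m \<and> m \<le> - 1}"
  by (auto simp: C_window_def set_C_factor)

lemma windows_equiv:
  assumes "n \<ge> 1"
  shows "factors_equiv n x (B_window n K) (staircase n (- 2 * int K) @ map forget_prime (C_window n K))"
  unfolding B_window_def C_window_def by (rule B_factors_staircase[OF assms])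

text \<open>A term using a factor of the initial staircase has a \<open>q\<close>-degree close to \<open>- 2 K\<close>, so it cannot
  contribute to the coefficient of \<open>q\<^bsup>- e\<^esup>\<close>.\<close>

lemma card_windows:
  assumes "n \<ge> 1" and inv: "Hecke_invariant n (\<lambda>a. if a \<in> A then 1 else 0 :: qseries)"
    and K: "e + int n + int n * int p < 2 * int K"
  shows "card {ys. sorted_wrt level_desc ys \<and> set ys \<subseteq> set (B_window n K) \<and> map fst ys \<in> A \<and>
       length ys = p \<and> (\<Sum>e\<leftarrow>ys. snd e - 1) = - e} =
     card {ys. sorted_wrt level_asc ys \<and> set ys \<subseteq> set (C_window n K) \<and> map (\<lambda>e. unprime (fst e)) ys \<in> A \<and>
       length ys = p \<and> (\<Sum>e\<leftarrow>ys. level_index e - 1) = - e}"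
    (is "card ?L = card ?R")
proof -
  let ?f = "\<lambda>a. if a \<in> A then 1 else 0 :: qseries"
  let ?g = "factors q_weight (map forget_prime (C_window n K)) ?f"
  have "degree_bounded (int n) ?f"
    by (auto simp: degree_bounded_def)
  then have bounded: "degree_bounded (int n) ?g"
    by (rule degree_bounded_factors)
      (auto simp: set_C_window forget_prime_def level_index_def letters_def)
  have "rat_of_nat (card ?L) = fps_nth (factors q_weight (B_window n K) ?f []) p $$ e"
    using factors_q_weight_nth[OF level_desc sorted_B_window, of id] by simp
  also have "factors q_weight (B_window n K) ?f = factors q_weight (staircase n (- 2 * int K)) ?g"
    using windows_equiv[OF assms(1), of q_weight K, unfolded factors_equiv_def, rule_format, OF inv]
    by (simp add: factors_append)
  \<comment> \<open>Indices in this staircase are below \<open>int n - 2 * int K\<close>, so the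
    choice of \<open>K\<close> keeps all of them away from the coefficient at
    \<open>e\<close>.\<close>
  also have "fps_nth (factors q_weight (staircase n (- 2 * int K)) ?g []) p $$ e = fps_nth (?g []) p $$ e"
    by (rule factors_truncate[OF bounded]) (use K in \<open>auto simp: set_staircase\<close>)
  also have "\<dots> = rat_of_nat (card ?R)"
    using factors_q_weight_nth[OF level_asc sorted_C_window, of forget_prime] by (simp add: forget_prime_def)
  finally show ?thesis by simp
qed

section \<open>Primed words and comajor index\<close>

text \<open>Weakly increasing negative levels attached to the letters of \<open>a\<close>, with equality allowed only at
  ascents; expanding \<open>1 / ((q\<^sup>2 - 1) \<cdots> (q\<^bsup>2p\<^esup> - 1))\<close> in \<open>q\<^sup>-\<^sup>1\<close> amounts to summing over them.\<close>

definition level_words :: "primed_letter list \<Rightarrow> (primed_letter \<times> int) list set" where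
  "level_words a = {ys. map fst ys = a \<and> sorted_wrt level_asc ys \<and> (\<forall>e\<in>set ys. snd e \<le> - 1)}"

definition level_words_sum :: "primed_letter list \<Rightarrow> int \<Rightarrow> (primed_letter \<times> int) list set" where
  "level_words_sum a e = {ys \<in> level_words a. 2 * (\<Sum>y\<leftarrow>ys. snd y) = - e}"

definition ascents :: "primed_letter list \<Rightarrow> nat set" where
  "ascents a = {i. 1 \<le> i \<and> i < length a \<and> a ! (i - 1) \<prec> a ! i}"

lemma ascents_snoc:
  "ascents (a @ [x]) = ascents a \<union> (if a \<noteq> [] \<and> last a \<prec> x then {length a} else {})"
proof -
  have last: "length a \<in> ascents (a @ [x]) \<longleftrightarrow> a \<noteq> [] \<and> last a \<prec> x"
  proof (cases "a = []")
    case False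
    then have len: "length a - 1 < length a" "1 \<le> length a" by (cases a; simp)+
    have "(a @ [x]) ! (length a - 1) = last a"
      unfolding nth_append last_conv_nth[OF False] using len(1) by (rule if_P)
    moreover have "(a @ [x]) ! length a = x" by (rule nth_append_length)
    ultimately show ?thesis using False len(2) by (simp only: ascents_def mem_Collect_eq) simp
  qed (simp add: ascents_def)
  have other: "i \<in> ascents (a @ [x]) \<longleftrightarrow> i \<in> ascents a" if "i \<noteq> length a" for i
    using that by (cases "i < length a") (simp_all add: ascents_def nth_append less_imp_diff_less)
  have "length a \<notin> ascents a" by (simp add: ascents_def)
  then have "i \<in> ascents (a @ [x]) \<longleftrightarrow>
      i \<in> ascents a \<union> (if a \<noteq> [] \<and> last a \<prec> x then {length a} else {})" for i
    using last other[of i] by (cases "i = length a") simp_all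
  then show ?thesis by (rule set_eqI)
qed

lemma sum_ascents_snoc:
  "(\<Sum>i\<in>ascents (a @ [x]). 2 * i) = (\<Sum>i\<in>ascents a. 2 * i) + (if a \<noteq> [] \<and> last a \<prec> x then 2 * length a else 0)"
proof -
  have "finite (ascents a)" by (rule finite_subset[of _ "{..<length a}"]) (auto simp: ascents_def)
  moreover have "length a \<notin> ascents a" by (simp add: ascents_def)
  ultimately show ?thesis unfolding ascents_snoc by simp
qed

lemma sum_level_lower_bound:
  assumes "\<forall>e\<in>set ys. snd e \<le> - 1" "y \<in> set ys"
  shows "(\<Sum>y\<leftarrow>ys. snd y) \<le> (snd y :: int)"
proof -
  obtain us vs where ys: "ys = us @ y # vs" using assms(2) by (metis split_list)
  have "(\<Sum>y\<leftarrow>zs. snd y) \<le> 0" if "\<forall>e\<in>set zs. snd e \<le> - 1" for zs :: "('a \<times> int) list"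
    using that by (induction zs) auto
  from this[of us] this[of vs] show ?thesis using assms(1) ys by auto
qed

lemma finite_level_words_sum: "finite (level_words_sum a e)"
proof (rule finite_subset)
  show "level_words_sum a e \<subseteq> {ys. set ys \<subseteq> set a \<times> {- \<bar>e\<bar>..- 1} \<and> length ys = length a}"
  proof
    fix ys assume ys: "ys \<in> level_words_sum a e"
    then have "length ys = length a" by (auto simp: level_words_sum_def level_words_def)
    moreover have "y \<in> set a \<times> {- \<bar>e\<bar>..- 1}" if y: "y \<in> set ys" for y
    proof -
      have "fst y \<in> set a" "snd y \<le> - 1" "2 * snd y \<ge> - e"
        using ys y sum_level_lower_bound[of ys y]
        by (auto simp: level_words_sum_def level_words_def)
      then show ?thesis by (cases y) auto
    qed
    ultimately show "ys \<in> {ys. set ys \<subseteq> set a \<times> {- \<bar>e\<bar>..- 1} \<and> length ys = length a}" by auto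
  qed
qed (intro finite_lists_length_eq finite_cartesian_product; simp)

lemma level_words_sum_neg: "e < 0 \<Longrightarrow> level_words_sum a e = {}"
proof -
  have "(\<Sum>y\<leftarrow>ys. snd y) \<le> 0" if "\<forall>e\<in>set ys. snd e \<le> - 1" for ys :: "(primed_letter \<times> int) list"
    using that by (induction ys) auto
  then show "e < 0 \<Longrightarrow> level_words_sum a e = {}"
    by (fastforce simp: level_words_sum_def level_words_def)
qed

section \<open>Recursion on the last letter of a level word\<close>

definition shift_level :: "int \<Rightarrow> primed_letter \<times> int \<Rightarrow> primed_letter \<times> int" where
  "shift_level c y = (fst y, snd y + c)"

lemma shift_level:
  "fst (shift_level c y) = fst y" "snd (shift_level c y) = snd y + c"
  "level_asc (shift_level c y) (shift_level c z) \<longleftrightarrow> level_asc y z"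
  by (auto simp: shift_level_def level_asc_def)

lemma sum_shift_level: "(\<Sum>y\<leftarrow>map (shift_level c) ys. snd y) = (\<Sum>y\<leftarrow>ys. snd y) + c * int (length ys)"
  by (induction ys) (auto simp: shift_level algebra_simps)

lemma sorted_shift_level: "sorted_wrt level_asc (map (shift_level c) ys) \<longleftrightarrow> sorted_wrt level_asc ys"
  by (simp add: sorted_wrt_map shift_level)

lemma inj_shift_level: "inj (map (shift_level c))"
  by (intro inj_mapI injI) (auto simp: shift_level_def prod_eq_iff)

lemma shift_level_inverse: "map (shift_level c) (map (shift_level (- c)) ys) = ys"
  by (induction ys) (auto simp: shift_level_def)

text \<open>Level words avoiding level -1 correspond to arbitrary ones by moving all levels by one,
  which changes the doubled sum by twice the length.\<close>

lemma level_words_shift: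
  "{ys. map fst ys = a \<and> sorted_wrt level_asc ys \<and> (\<forall>e\<in>set ys. snd e \<le> - 2) \<and> 2 * (\<Sum>y\<leftarrow>ys. snd y) = - e} =
     map (shift_level (- 1)) ` level_words_sum a (e - 2 * int (length a))"
    (is "?L = ?R")
proof
  show "?R \<subseteq> ?L"
  proof
    fix ys assume "ys \<in> ?R"
    then obtain zs where zs: "ys = map (shift_level (- 1)) zs" "zs \<in> level_words_sum a (e - 2 * int (length a))"
      by blast
    have "map fst ys = map fst zs" "\<forall>e\<in>set ys. snd e \<le> - 2"
      using zs by (auto simp: level_words_sum_def level_words_def shift_level)
    moreover have "length zs = length a" using zs by (auto simp: level_words_sum_def level_words_def)
    moreover have "(\<Sum>y\<leftarrow>ys. snd y) = (\<Sum>y\<leftarrow>zs. snd y) - int (length zs)"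
      unfolding zs(1) sum_shift_level by simp
    moreover have "sorted_wrt level_asc ys"
      unfolding zs(1) sorted_shift_level using zs(2) by (simp add: level_words_sum_def level_words_def)
    ultimately show "ys \<in> ?L"
      using zs(2) by (simp add: level_words_sum_def level_words_def)
  qed
  show "?L \<subseteq> ?R"
  proof
    fix ys assume ys: "ys \<in> ?L"
    then have "map (shift_level 1) ys \<in> level_words_sum a (e - 2 * int (length a))"
      unfolding level_words_sum_def level_words_def mem_Collect_eq sorted_shift_level sum_shift_level
      by (auto simp: shift_level o_def)
    then show "ys \<in> ?R"
      by (rule image_eqI[rotated]) (use shift_level_inverse[of "- 1" ys] in simp)
  qed
qed

lemma level_asc_last:
  assumes "sorted_wrt level_asc ys" "y \<in> set ys"
  shows "y = last ys \<or> level_asc y (last ys)" "snd y \<le> snd (last ys)"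
proof -
  from assms(2) obtain us where us: "ys = us @ [last ys]" by (metis append_butlast_last_id empty_iff empty_set)
  have "sorted_wrt level_asc (us @ [last ys])" "y \<in> set (us @ [last ys])"
    using assms us by simp_all
  then show "y = last ys \<or> level_asc y (last ys)" by (auto simp: sorted_wrt_append)
  then show "snd y \<le> snd (last ys)" by (auto simp: level_asc_def)
qed

text \<open>Removing the last letter, of level -1, leaves a level word that may itself end at -1 if
  the step is an ascent. Otherwise it must stay at -2 or below, and \<open>level_words_shift\<close>
  applies. For empty \<open>a\<close> both branches would give the same set.\<close>

lemma level_words_last:
  "{ys \<in> level_words_sum (a @ [x]) (e + 2 * int (length a) + 2). snd (last ys) = - 1} =
   (if a \<noteq> [] \<and> last a \<prec> x
    then (\<lambda>ys. ys @ [(x, - 1)]) ` level_words_sum a (e + 2 * int (length a))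
    else (\<lambda>ys. ys @ [(x, - 1)]) ` map (shift_level (- 1)) ` level_words_sum a e)"
    (is "?L = ?R")
proof -
  let ?E = "e + 2 * int (length a)"
  have L: "?L = (\<lambda>ys. ys @ [(x, - 1)]) ` {ys \<in> level_words_sum a ?E. \<forall>y\<in>set ys. level_asc y (x, - 1)}"
    (is "_ = _ ` ?M")
  proof (intro equalityI subsetI)
    fix ys assume ys: "ys \<in> ?L"
    then obtain zs y where "ys = zs @ [y]" "map fst zs = a" "fst y = x"
      by (auto simp: level_words_sum_def level_words_def map_eq_append_conv)
    then show "ys \<in> (\<lambda>ys. ys @ [(x, - 1)]) ` ?M"
      using ys by (cases y) (auto simp: level_words_sum_def level_words_def sorted_wrt_append)
  qed (auto simp: level_words_sum_def level_words_def sorted_wrt_append)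
  show ?thesis
  proof (cases "a \<noteq> [] \<and> last a \<prec> x")
    case True
    have "level_asc y (x, - 1)" if ys: "ys \<in> level_words_sum a ?E" and y: "y \<in> set ys" for ys y
    proof -
      from y have "ys \<noteq> []" by auto
      have "fst (last ys) = last a" "snd (last ys) \<le> - 1"
        using ys \<open>ys \<noteq> []\<close> by (auto simp: level_words_sum_def level_words_def last_map)
      then have l: "level_asc (last ys) (x, - 1)" using True by (auto simp: level_asc_def)
      have "y = last ys \<or> level_asc y (last ys)"
        using ys y by (intro level_asc_last) (auto simp: level_words_sum_def level_words_def)
      then show ?thesis using l transpD[OF level_asc(1)] by metis
    qed
    then have "?M = level_words_sum a ?E" by auto
    then show ?thesis using L True by simp
  next
    case False
    have iff: "(\<forall>y\<in>set ys. level_asc y (x, - 1)) \<longleftrightarrow> (\<forall>y\<in>set ys. snd y \<le> - 2)"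
      if ys: "ys \<in> level_words a" for ys
    proof
      assume asc: "\<forall>y\<in>set ys. level_asc y (x, - 1)"
      show "\<forall>y\<in>set ys. snd y \<le> - 2"
      proof
        fix y assume y: "y \<in> set ys"
        then have "ys \<noteq> []" by auto
        have "fst (last ys) = last a" "a \<noteq> []"
          using ys \<open>ys \<noteq> []\<close> by (auto simp: level_words_def last_map)
        moreover have "level_asc (last ys) (x, - 1)" using asc \<open>ys \<noteq> []\<close> by simp
        ultimately have "snd (last ys) \<le> - 2" using False by (auto simp: level_asc_def)
        moreover have "snd y \<le> snd (last ys)"
          using ys y by (intro level_asc_last) (auto simp: level_words_def)
        ultimately show "snd y \<le> - 2" by simp
      qed
    qed (auto simp: level_asc_def)
    have "?M = {ys \<in> level_words_sum a ?E. \<forall>y\<in>set ys. snd y \<le> - 2}"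
    proof (rule Collect_cong, rule conj_cong[OF refl])
      show "(\<forall>y\<in>set ys. level_asc y (x, - 1)) \<longleftrightarrow> (\<forall>y\<in>set ys. snd y \<le> - 2)"
        if "ys \<in> level_words_sum a ?E" for ys
        by (rule iff) (use that in \<open>simp add: level_words_sum_def\<close>)
    qed
    also have "\<dots> = {ys. map fst ys = a \<and> sorted_wrt level_asc ys \<and> (\<forall>e\<in>set ys. snd e \<le> - 2) \<and>
        2 * (\<Sum>y\<leftarrow>ys. snd y) = - ?E}"
    proof -
      have "\<forall>e\<in>set ys. snd e \<le> - 1" if "\<forall>e\<in>set ys. snd e \<le> - 2" for ys :: "(primed_letter \<times> int) list"
        using that by fastforce
      then show ?thesis unfolding level_words_sum_def level_words_def by blast
    qed
    also have "\<dots> = map (shift_level (- 1)) ` level_words_sum a e"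
      unfolding level_words_shift by simp
    finally show ?thesis using L False by auto
  qed
qed

text \<open>Splitting by whether the last level is \<open>- 1\<close> gives the coefficients of the recursion
  \<open>(q\<^bsup>2p\<^esup> - 1) G(a x) = q\<^bsup>2(p - 1)\<^esup> G(a)\<close> or \<open>G(a)\<close>, with \<open>p\<close> the length of \<open>a x\<close>.\<close>

lemma card_level_words_snoc:
  "card (level_words_sum (a @ [x]) (e + 2 * int (length a) + 2)) = card (level_words_sum (a @ [x]) e) +
     card (level_words_sum a (e + (if a \<noteq> [] \<and> last a \<prec> x then 2 * int (length a) else 0)))"
proof -
  let ?W = "level_words_sum (a @ [x]) (e + 2 * int (length a) + 2)"
  have "{ys \<in> ?W. snd (last ys) \<noteq> - 1} = {ys. map fst ys = a @ [x] \<and> sorted_wrt level_asc ys \<and>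
      (\<forall>e\<in>set ys. snd e \<le> - 2) \<and> 2 * (\<Sum>y\<leftarrow>ys. snd y) = - (e + 2 * int (length a) + 2)}"
    (is "?L = ?R")
  proof (intro equalityI subsetI)
    fix ys assume ys: "ys \<in> ?L"
    then have "ys \<noteq> []" by (auto simp: level_words_sum_def level_words_def)
    then have "snd (last ys) \<le> - 1" "snd (last ys) \<noteq> - 1"
      using ys last_in_set[of ys] by (auto simp: level_words_sum_def level_words_def)
    then have "snd y \<le> - 2" if "y \<in> set ys" for y
      using level_asc_last(2)[OF _ that] ys by (auto simp: level_words_sum_def level_words_def)
    then show "ys \<in> ?R" using ys by (auto simp: level_words_sum_def level_words_def)
  next
    fix ys assume ys: "ys \<in> ?R"
    then have "ys \<noteq> []" by auto
    then have "snd (last ys) \<le> - 2" using ys by simp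
    then show "ys \<in> ?L" using ys by (fastforce simp: level_words_sum_def level_words_def)
  qed
  also have "\<dots> = map (shift_level (- 1)) ` level_words_sum (a @ [x]) e"
    unfolding level_words_shift by (simp add: algebra_simps)
  finally have "card {ys \<in> ?W. snd (last ys) \<noteq> - 1} = card (level_words_sum (a @ [x]) e)"
    by (simp only: card_image[OF inj_on_subset[OF inj_shift_level subset_UNIV]])
  moreover have "card {ys \<in> ?W. snd (last ys) = - 1} =
      card (level_words_sum a (e + (if a \<noteq> [] \<and> last a \<prec> x then 2 * int (length a) else 0)))"
  proof -
    have "inj_on (\<lambda>ys. ys @ [(x, - 1)]) A" for A :: "(primed_letter \<times> int) list set"
      by (simp add: inj_on_def)
    then show ?thesis
      unfolding level_words_last
      by (simp add: card_image card_image[OF inj_on_subset[OF inj_shift_level subset_UNIV]])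
  qed
  moreover have "card ?W = card {ys \<in> ?W. snd (last ys) \<noteq> - 1} + card {ys \<in> ?W. snd (last ys) = - 1}"
    using finite_level_words_sum[of "a @ [x]"]
    by (subst card_Un_disjoint[symmetric]) (auto intro!: arg_cong[of _ _ card])
  ultimately show ?thesis by simp
qed

lemma q_power_ne_1: "k > 0 \<Longrightarrow> q ^ k - 1 \<noteq> 0"
proof
  assume "k > 0" "q ^ k - 1 = 0"
  then have "(q ^ k) $$ 0 = 1" by simp
  then show False using \<open>k > 0\<close> q_powi_nth[of "int k" 0] by simp
qed

text \<open>The P-partition argument: the quotient is the generating series of level words in
  q^{-1}. Denominators are cleared first, so that \<open>card_level_words_snoc\<close> gives the
  induction step for words built from the right.\<close>

lemma comaj_nth:
  "(q ^ (\<Sum>i\<in>ascents a. 2 * i) / (\<Prod>i = 1..length a. (q ^ (2 * i) - 1))) $$ e =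
     of_nat (card (level_words_sum a e))"
proof -
  define G :: "primed_letter list \<Rightarrow> rat fls" where
    "G a = Abs_fls (\<lambda>e. of_nat (card (level_words_sum a e)))" for a
  have G: "G a $$ e = of_nat (card (level_words_sum a e))" for a e
    unfolding G_def by (rule nth_Abs_fls_lower_bound[of 0]) (simp add: level_words_sum_neg)
  have "G a * (\<Prod>i = 1..length a. (q ^ (2 * i) - 1)) = q ^ (\<Sum>i\<in>ascents a. 2 * i)"
  proof (induction a rule: rev_induct)
    case Nil
    have "level_words_sum [] e = (if e = 0 then {[]} else {})" for e
      by (auto simp: level_words_sum_def level_words_def)
    then have "G [] = 1" by (intro fls_eqI) (simp add: G)
    then show ?case by (simp add: ascents_def)
  next
    case (snoc x a)
    let ?k = "if a \<noteq> [] \<and> last a \<prec> x then 2 * length a else 0"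
    let ?D = "q ^ (2 * Suc (length a)) - 1"
    let ?P = "\<Prod>i = 1..length a. (q ^ (2 * i) - 1)"
    have "(q ^ (2 * Suc (length a)) - 1) * G (a @ [x]) = q ^ ?k * G a"
    proof (rule fls_eqI)
      fix e
      have "((q ^ (2 * Suc (length a)) - 1) * G (a @ [x])) $$ e =
          of_nat (card (level_words_sum (a @ [x]) (e + 2 * int (length a) + 2))) -
          of_nat (card (level_words_sum (a @ [x]) e))"
        unfolding left_diff_distrib mult_1_left fls_minus_nth q_power_mult_nth G by (simp add: add_ac)
      also have "\<dots> = of_nat (card (level_words_sum a (e + int ?k)))"
        unfolding card_level_words_snoc by simp
      finally show "((q ^ (2 * Suc (length a)) - 1) * G (a @ [x])) $$ e = (q ^ ?k * G a) $$ e"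
        by (simp only: q_power_mult_nth G)
    qed
    then have eq: "?D * G (a @ [x]) = q ^ ?k * G a" .
    have "(\<Prod>i = 1..length (a @ [x]). (q ^ (2 * i) - 1)) = ?P * ?D"
      by (simp only: length_append_singleton prod.cl_ivl_Suc) simp
    then have "G (a @ [x]) * (\<Prod>i = 1..length (a @ [x]). (q ^ (2 * i) - 1)) = ?P * (?D * G (a @ [x]))"
      by (simp only: mult_ac)
    also have "\<dots> = (G a * ?P) * q ^ ?k" unfolding eq by (simp only: mult_ac)
    also have "\<dots> = q ^ (\<Sum>i\<in>ascents (a @ [x]). 2 * i)"
      unfolding snoc sum_ascents_snoc power_add ..
    finally show ?case .
  qed
  moreover have "(\<Prod>i = 1..length a. (q ^ (2 * i) - 1)) \<noteq> 0"
    using q_power_ne_1 by simp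
  ultimately have "q ^ (\<Sum>i\<in>ascents a. 2 * i) / (\<Prod>i = 1..length a. (q ^ (2 * i) - 1)) = G a"
    by (simp add: field_simps)
  then show ?thesis using G by simp
qed

text \<open>Separates off the letterwise part of the exponent, which is exactly what
  \<open>level_index\<close> adds to \<open>2 * snd e + 1\<close>, from the ascent part treated by
  \<open>comaj_nth\<close>.\<close>

lemma Sigma_comaj_D:
  "int (Sigma_D a + comaj_D a) =
     (\<Sum>l\<leftarrow>a. of_bool (0 < unprime l) + (if is_unprimed l then \<bar>unprime l\<bar> else 0)) + int (\<Sum>i\<in>ascents a. 2 * i)"
proof -
  have "int (Sigma_D a) = (\<Sum>i<length a. if is_unprimed (a ! i) then \<bar>unprime (a ! i)\<bar> else 0)"
    by (simp add: Sigma_D_def sum.inter_filter[symmetric] lessThan_def)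
  moreover have "int (card {i. i < length a \<and> 0 < unprime (a ! i)}) = (\<Sum>i<length a. of_bool (0 < unprime (a ! i)))"
    by (simp add: of_bool_def sum.If_cases Int_def)
  ultimately show ?thesis
    by (simp add: comaj_D_def ascents_def sum_list_sum_nth sum.distrib atLeast0LessThan)
qed

lemma summand_nth:
  "(q ^ (Sigma_D a + comaj_D a) / (\<Prod>i = 1..length a. (q ^ (2 * i) - 1))) $$ e =
     of_nat (card {ys \<in> level_words a. (\<Sum>y\<leftarrow>ys. level_index y - 1) = - e})"
proof -
  define W where "W = (\<Sum>l\<leftarrow>a. of_bool (0 < unprime l) + (if is_unprimed l then \<bar>unprime l\<bar> else 0))"
  define k where "k = (\<Sum>i\<in>ascents a. 2 * i)"
  have "W \<ge> 0" unfolding W_def by (intro sum_list_nonneg) auto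
  then have "Sigma_D a + comaj_D a = nat W + k"
    using Sigma_comaj_D[of a] unfolding W_def[symmetric] k_def[symmetric] by simp
  then have "(q ^ (Sigma_D a + comaj_D a) / (\<Prod>i = 1..length a. (q ^ (2 * i) - 1))) $$ e =
      (q ^ nat W * (q ^ k / (\<Prod>i = 1..length a. (q ^ (2 * i) - 1)))) $$ e"
    by (simp add: power_add)
  also have "\<dots> = of_nat (card (level_words_sum a (e + W)))"
    using \<open>W \<ge> 0\<close> by (simp only: q_power_mult_nth k_def comaj_nth) simp
  also have "level_words_sum a (e + W) = {ys \<in> level_words a. (\<Sum>y\<leftarrow>ys. level_index y - 1) = - e}"
  proof -
    have "(\<Sum>y\<leftarrow>ys. level_index y - 1) = 2 * (\<Sum>y\<leftarrow>ys. snd y) + W" if "ys \<in> level_words a" for ys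
    proof -
      have "(\<Sum>y\<leftarrow>ys. level_index y - 1) = 2 * (\<Sum>y\<leftarrow>ys. snd y) +
         (\<Sum>l\<leftarrow>map fst ys. of_bool (0 < unprime l) + (if is_unprimed l then \<bar>unprime l\<bar> else 0))"
        by (induction ys) (auto simp: level_index_def)
      moreover have "map fst ys = a" using that by (simp add: level_words_def)
      ultimately show ?thesis by (simp only: W_def)
    qed
    then show ?thesis by (auto simp: level_words_sum_def)
  qed
  finally show ?thesis .
qed

section \<open>The principal specialization\<close>

text \<open>Turns a sum whose terms count the fibres of \<open>g\<close> into the size of one finite
  set; both sides of the theorem are of this kind.\<close>

lemma sum_card_fibres:
  assumes "finite Z" "\<And>i. i \<in> I \<Longrightarrow> t i = of_nat (card {z \<in> Z. g z = i})" "g ` Z \<subseteq> I"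
  shows "(\<Sum>i | i \<in> I \<and> t i \<noteq> 0. t i) = (of_nat (card Z) :: 'a::semiring_char_0)"
proof -
  have "{i \<in> I. t i \<noteq> 0} = g ` Z"
    using assms by (fastforce simp: card_eq_0_iff)
  then have "(\<Sum>i | i \<in> I \<and> t i \<noteq> 0. t i) = (\<Sum>i\<in>g ` Z. of_nat (card {z \<in> Z. g z = i}))"
    using assms(2,3) by (intro sum.cong) auto
  also have "\<dots> = of_nat (card Z)"
    using sum.image_gen[OF assms(1), of "\<lambda>_. 1 :: nat" g] by (simp add: of_nat_sum[symmetric] del: of_nat_sum)
  finally show ?thesis .
qed

text \<open>Read backwards, it keeps every entry from being very negative once the total is fixed;
  this is why finite windows suffice.\<close>

lemma sum_list_le_member:
  fixes zs :: "int list"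
  assumes "\<forall>z\<in>set zs. z \<le> c" "0 \<le> c" "z \<in> set zs"
  shows "sum_list zs \<le> z + c * int (length zs)"
proof -
  have bound: "sum_list us \<le> c * int (length us)" if "\<forall>z\<in>set us. z \<le> c" for us
    using that by (induction us) (auto simp: algebra_simps)
  obtain us vs where zs: "zs = us @ z # vs" using assms(3) by (metis split_list)
  show ?thesis using bound[of us] bound[of vs] assms(1,2) by (simp add: zs algebra_simps)
qed

text \<open>Weak increase of indices with strictness at weak ascents of the word is strict increase
  of the pairs for \<open>level_desc\<close>, whose transitivity reduces it to consecutive
  pairs.\<close>

lemma Compatible_iff:
  "map snd ys \<in> Compatible (map fst ys) \<longleftrightarrow>
     sorted_wrt level_desc ys \<and> (\<forall>(a, i)\<in>set ys. 0 < i \<longrightarrow> i \<le> a)"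
proof -
  have "(\<forall>j. Suc j < length ys \<longrightarrow> snd (ys ! j) \<le> snd (ys ! Suc j)) \<and>
      (\<forall>j. Suc j < length ys \<longrightarrow> fst (ys ! j) \<le> fst (ys ! Suc j) \<longrightarrow> snd (ys ! j) < snd (ys ! Suc j)) \<longleftrightarrow>
      (\<forall>j. Suc j < length ys \<longrightarrow> level_desc (ys ! j) (ys ! Suc j))"
    unfolding level_desc_def by (metis linorder_not_less order_le_less)
  moreover have "(\<forall>j<length ys. 0 < snd (ys ! j) \<longrightarrow> snd (ys ! j) \<le> fst (ys ! j)) \<longleftrightarrow>
      (\<forall>(a, i)\<in>set ys. 0 < i \<longrightarrow> i \<le> a)"
    by (auto simp: all_set_conv_all_nth split: prod.splits)
  ultimately show ?thesis
    unfolding Compatible_def sorted_wrt_iff_nth_Suc_transp[OF level_desc(1)] sorted_iff_nth_Suc mem_Collect_eq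
    by (auto simp: Suc_lessD)
qed

definition compatible_pairs ::
  "(int list \<Rightarrow> bool) \<Rightarrow> nat \<Rightarrow> int \<Rightarrow> (int list \<times> int list) set" where
  "compatible_pairs H p e =
     {(a, i). H a \<and> i \<in> Compatible a \<and> length a = p \<and> (\<Sum>x\<leftarrow>i. x - 1) = - e}"

text \<open>A fixed degree in q bounds the indices from below, so for large \<open>K\<close> the
  window holds every pair of a letter and its index.\<close>

lemma bij_betw_compatible_pairs:
  assumes "n \<ge> 1" and H: "\<And>a. H a \<Longrightarrow> set a \<subseteq> letters n" and K: "e + int n * int p \<le> 2 * int K"
  shows "bij_betw (\<lambda>ys. (map fst ys, map snd ys))
     {ys. sorted_wrt level_desc ys \<and> set ys \<subseteq> set (B_window n K) \<and> H (map fst ys) \<and>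
       length ys = p \<and> (\<Sum>e\<leftarrow>ys. snd e - 1) = - e} (compatible_pairs H p e)"
    (is "bij_betw ?f ?L _")
  unfolding bij_betw_def
proof
  show "inj_on ?f ?L"
    by (rule inj_on_inverseI[where g = "\<lambda>(a, i). zip a i"]) (simp add: zip_map_fst_snd)
  show "?f ` ?L = compatible_pairs H p e"
  proof (intro equalityI subsetI)
    fix z assume "z \<in> ?f ` ?L"
    then obtain ys where ys: "ys \<in> ?L" "z = ?f ys" by blast
    then have "map snd ys \<in> Compatible (map fst ys)"
      unfolding Compatible_iff by (auto simp: set_B_window)
    then show "z \<in> compatible_pairs H p e"
      using ys by (simp add: compatible_pairs_def o_def)
  next
    fix z assume z: "z \<in> compatible_pairs H p e"
    obtain a i where ai: "z = (a, i)" by fastforce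
    define ys where "ys = zip a i"
    have C: "H a" "i \<in> Compatible a" "length a = p" "(\<Sum>x\<leftarrow>i. x - 1) = - e"
      using z ai by (auto simp: compatible_pairs_def)
    then have "length i = length a" by (simp add: Compatible_def)
    then have maps: "map fst ys = a" "map snd ys = i" by (simp_all add: ys_def)
    have low: "1 - 2 * int K \<le> x" if "x \<in> set i" for x
    proof -
      have "y - 1 \<le> int n" if "y \<in> set i" for y
        using Compatible_less[OF assms(1) H[OF C(1)] C(2) that] by simp
      then have "(\<Sum>x\<leftarrow>i. x - 1) \<le> (x - 1) + int n * int (length (map (\<lambda>x. x - 1) i))"
        using that by (intro sum_list_le_member) auto
      then show ?thesis using C(3,4) K \<open>length i = length a\<close> by simp
    qed
    have srt: "sorted_wrt level_desc ys" "\<forall>(a, i)\<in>set ys. 0 < i \<longrightarrow> i \<le> a"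
      using C(2) unfolding maps[symmetric] Compatible_iff by auto
    have "set ys \<subseteq> set (B_window n K)"
    proof
      fix y assume y: "y \<in> set ys"
      then have "fst y \<in> set a" "snd y \<in> set i" using maps by auto
      then have "fst y \<in> letters n" "1 - 2 * int K \<le> snd y"
        using H[OF C(1)] low by auto
      then show "y \<in> set (B_window n K)" using srt(2) y by (auto simp: set_B_window)
    qed
    moreover have "(\<Sum>e\<leftarrow>ys. snd e - 1) = - e"
      using C(4) unfolding maps(2)[symmetric] by (simp add: o_def)
    ultimately have "ys \<in> ?L" using srt(1) C maps by auto
    then show "z \<in> ?f ` ?L" using ai maps by (intro image_eqI[of _ _ ys]) auto
  qed
qed

text \<open>The primed counterpart: \<open>level_index y - 1\<close> exceeds twice the level by at
  most \<open>int n\<close>, so a fixed degree bounds the levels from below.\<close>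

lemma level_words_window:
  assumes "n \<ge> 1" and H: "\<And>a. H a \<Longrightarrow> set a \<subseteq> letters n" and K: "e + int n + int n * int p < 2 * int K"
  shows "{ys. sorted_wrt level_asc ys \<and> set ys \<subseteq> set (C_window n K) \<and> H (map (\<lambda>e. unprime (fst e)) ys) \<and>
       length ys = p \<and> (\<Sum>e\<leftarrow>ys. level_index e - 1) = - e} =
     {ys. ys \<in> level_words (map fst ys) \<and> H (map (\<lambda>e. unprime (fst e)) ys) \<and>
       length ys = p \<and> (\<Sum>e\<leftarrow>ys. level_index e - 1) = - e}"
    (is "?L = ?R")
proof (intro equalityI subsetI)
  fix ys assume "ys \<in> ?L"
  then show "ys \<in> ?R" by (auto simp: level_words_def set_C_window)
next
  fix ys assume ys: "ys \<in> ?R"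
  have letters: "unprime (fst y) \<in> letters n" if "y \<in> set ys" for y
    using ys H[of "map (\<lambda>e. unprime (fst e)) ys"] that by auto
  have index: "level_index y - 1 \<le> 2 * snd y + int n" if "y \<in> set ys" for y
    using letters[OF that] by (auto simp: level_index_def letters_def)
  have neg: "snd y \<le> - 1" if "y \<in> set ys" for y using ys that by (simp add: level_words_def)
  have "- int K \<le> snd y" if y: "y \<in> set ys" for y
  proof -
    have "\<forall>z\<in>set (map (\<lambda>e. level_index e - 1) ys). z \<le> int n"
      using index neg by fastforce
    then have "(\<Sum>e\<leftarrow>ys. level_index e - 1) \<le>
        (level_index y - 1) + int n * int (length (map (\<lambda>e. level_index e - 1) ys))"
      using y by (intro sum_list_le_member) auto
    then show ?thesis using ys index[OF y] K by auto
  qed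
  then show "ys \<in> ?L" using ys letters neg by (auto simp: level_words_def set_C_window)
qed

lemma sum_mset_mset: "(\<Sum>x\<in>#mset i. f x) = (\<Sum>x\<leftarrow>i. f x)"
  by (induction i) auto

lemma power_beta: "([:0, 1:] :: int poly) ^ k = monom 1 k"
  by (simp add: monom_altdef)

text \<open>A word of length p carries beta to the power p - \<open>len_D n w\<close>, hence the
  length \<open>k + len_D n w\<close>. The degree in q is fixed by \<open>M\<close>, so for any
  other \<open>e\<close> the set is empty.\<close>

lemma specialize_term_Groth_D_nth:
  "fps_nth (specialize_term (Groth_D n scale \<pi> w) M) k $$ e =
     of_nat (card {z \<in> compatible_pairs (\<lambda>a. a \<in> Hecke_D n scale \<pi> w) (k + len_D n w) e. mset (snd z) = M})"
proof -
  let ?I = "{(a, i). a \<in> Hecke_D n scale \<pi> w \<and> i \<in> Compatible a \<and> mset i = M}"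
  let ?Z = "{z \<in> compatible_pairs (\<lambda>a. a \<in> Hecke_D n scale \<pi> w) (k + len_D n w) e. mset (snd z) = M}"
  have len: "length i = length a" "len_D n w \<le> length i" if "(a, i) \<in> ?I" for a i
    using that by (auto simp: Compatible_def Hecke_D_def)
  have "coeff (Groth_D n scale \<pi> w M) k =
      (\<Sum>z\<in>?I. if length (snd z) = k + len_D n w then 1 else 0)"
    unfolding Groth_D_def coeff_sum
    by (rule sum.cong[OF refl]) (use len in \<open>fastforce simp: power_beta\<close>)
  also have "\<dots> = of_nat (card {z \<in> ?I. length (snd z) = k + len_D n w})"
    using finite_Groth_D_index[of n scale \<pi> w M] by (simp add: sum.If_cases Int_def)
  finally have c: "coeff (Groth_D n scale \<pi> w M) k = of_nat (card {z \<in> ?I. length (snd z) = k + len_D n w})" .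
  have s: "(\<Sum>x\<leftarrow>i. x - 1) = (\<Sum>i\<in>#M. i - 1)" if "mset i = M" for i
    using that sum_mset_mset[of "\<lambda>x. x - 1" i] by simp
  have C: "length i = length a" if "i \<in> Compatible a" for a i
    using that by (simp add: Compatible_def)
  show ?thesis
  proof (cases "e = - (\<Sum>i\<in>#M. i - 1)")
    case True
    have "z \<in> ?I \<and> length (snd z) = k + len_D n w \<longleftrightarrow> z \<in> ?Z" for z
      using s[of "snd z"] C[of "snd z" "fst z"] True
      by (cases z) (auto simp: compatible_pairs_def)
    then have "{z \<in> ?I. length (snd z) = k + len_D n w} = ?Z" by blast
    then have "coeff (Groth_D n scale \<pi> w M) k = of_nat (card ?Z)" using c by simp
    then show ?thesis using True by (simp add: specialize_term_nth)
  next
    case False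
    have "z \<notin> ?Z" for z
      using s[of "snd z"] False by (cases z) (auto simp: compatible_pairs_def)
    then have "?Z = {}" by blast
    then have "card ?Z = 0" by (simp only: card.empty)
    then show ?thesis using False by (simp only: specialize_term_nth if_False of_nat_0)
  qed
qed

theorem theorem3p9:
  fixes n :: nat and w :: "int \<Rightarrow> int"
    and scale :: "int poly \<Rightarrow> 'h::ring_1 \<Rightarrow> 'h" and \<pi> :: "(int \<Rightarrow> int) \<Rightarrow> 'h"
  assumes "n \<ge> 1"
    and "w \<in> WD n"
    and "id_coxeter_algebra_D scale n \<pi>"
  shows "specialize (Groth_D n scale \<pi> w) =
         formal_sum
           (\<lambda>a. fps_X ^ (length a - len_D n w) *
                fps_const (q ^ (Sigma_D a + comaj_D a) / (\<Prod>i = 1..length a. (q ^ (2 * i) - 1))))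
           (PrimedHecke_D n scale \<pi> w)"
    (is "_ = formal_sum ?t ?P")
proof (intro fps_ext fls_eqI)
  fix k e
  let ?H = "Hecke_D n scale \<pi> w"
  define p where "p = k + len_D n w"
  \<comment> \<open>The window is chosen after the coefficient at \<open>k\<close> and
    \<open>e\<close>, so no limit of products is formed.\<close>
  define K where "K = nat (\<bar>e + int n + int n * int p\<bar> + 1)"
  have "s < 2 * int (nat (\<bar>s\<bar> + 1))" for s by arith
  then have K: "e + int n + int n * int p < 2 * int K" unfolding K_def .
  have H: "set a \<subseteq> letters n" "len_D n w \<le> length a" if "a \<in> ?H" for a
    using that by (auto simp: Hecke_D_def)
  define L where "L = {ys. sorted_wrt level_desc ys \<and> set ys \<subseteq> set (B_window n K) \<and> map fst ys \<in> ?H \<and>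
       length ys = p \<and> (\<Sum>e\<leftarrow>ys. snd e - 1) = - e}"
  define R where "R = {ys. sorted_wrt level_asc ys \<and> set ys \<subseteq> set (C_window n K) \<and>
       map (\<lambda>e. unprime (fst e)) ys \<in> ?H \<and> length ys = p \<and> (\<Sum>e\<leftarrow>ys. level_index e - 1) = - e}"
  have fin: "finite L" "finite R"
    using finite_sorted_sublists[OF level_desc sorted_B_window, of n K]
      finite_sorted_sublists[OF level_asc sorted_C_window, of n K]
    unfolding L_def R_def by (auto elim: rev_finite_subset)
  let ?X = "compatible_pairs (\<lambda>a. a \<in> ?H) p e"
  have bij: "bij_betw (\<lambda>ys. (map fst ys, map snd ys)) L ?X"
    unfolding L_def by (rule bij_betw_compatible_pairs) (use assms H K in auto)
  have "fps_nth (specialize (Groth_D n scale \<pi> w)) k $$ e =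
      (\<Sum>M | M \<in> UNIV \<and> fps_nth (specialize_term (Groth_D n scale \<pi> w) M) k $$ e \<noteq> 0.
         fps_nth (specialize_term (Groth_D n scale \<pi> w) M) k $$ e)"
    using specialize_Groth_D_summable[OF assms(1), of scale \<pi> w] unfolding has_formal_sum_def by blast
  also have "\<dots> = of_nat (card ?X)"
    by (rule sum_card_fibres[where g = "\<lambda>z. mset (snd z)"])
      (use bij_betw_finite[OF bij] fin in \<open>auto simp: specialize_term_Groth_D_nth p_def\<close>)
  also have "card ?X = card L" using bij_betw_same_card[OF bij] by simp
  \<comment> \<open>Here the two sides meet, through the Yang-Baxter exchange of the
    windows.\<close>
  also have "card L = card R"
    unfolding L_def R_def
    by (rule card_windows[OF assms(1) id_coxeter_algebra_D.Hecke_invariant_Hecke_D[OF assms(3,2)] K])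
  \<comment> \<open>Grouping the level words by their underlying primed word recovers the summands
    on the right.\<close>
  also have "rat_of_nat (card R) = (\<Sum>a | a \<in> ?P \<and> fps_nth (?t a) k $$ e \<noteq> 0. fps_nth (?t a) k $$ e)"
  proof (rule sum_card_fibres[OF fin(2), where g = "map fst", symmetric])
    have R: "R = {ys. ys \<in> level_words (map fst ys) \<and> map (\<lambda>e. unprime (fst e)) ys \<in> ?H \<and>
       length ys = p \<and> (\<Sum>e\<leftarrow>ys. level_index e - 1) = - e}"
      unfolding R_def using H(1) by (intro level_words_window[OF assms(1) _ K]) auto
    show "map fst ` R \<subseteq> ?P" by (auto simp: R PrimedHecke_D_def o_def)
    fix a assume a: "a \<in> ?P"
    then have aH: "map unprime a \<in> ?H" by (simp add: PrimedHecke_D_def)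
    then have "len_D n w \<le> length a" using H(2) by fastforce
    then have "fps_nth (?t a) k $$ e = (if length a = p then
        of_nat (card {ys \<in> level_words a. (\<Sum>y\<leftarrow>ys. level_index y - 1) = - e}) else 0)"
      unfolding summand_nth[symmetric] by (auto simp: fps_X_power_mult_nth p_def)
    also have "\<dots> = of_nat (card {ys \<in> R. map fst ys = a})"
    proof (cases "length a = p")
      case True
      have "ys \<in> level_words a \<and> (\<Sum>y\<leftarrow>ys. level_index y - 1) = - e \<longleftrightarrow> ys \<in> R \<and> map fst ys = a" for ys
        using aH True by (auto simp: R level_words_def o_def)
      then show ?thesis using True by simp
    next
      case False
      then have "{ys \<in> R. map fst ys = a} = {}" by (auto simp: R)
      then show ?thesis using False by (simp only:) simp
    qed
    finally show "fps_nth (?t a) k $$ e = of_nat (card {ys \<in> R. map fst ys = a})" .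
  qed
  also have "\<dots> = fps_nth (formal_sum ?t ?P) k $$ e"
    using PrimedHecke_D_summable[of n w "\<lambda>a. q ^ (Sigma_D a + comaj_D a) / (\<Prod>i = 1..length a. (q ^ (2 * i) - 1))" scale \<pi>]
    unfolding has_formal_sum_def by metis
  finally show "fps_nth (specialize (Groth_D n scale \<pi> w)) k $$ e = fps_nth (formal_sum ?t ?P) k $$ e" .
qed

end
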